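(* Let $\Bbbk$ be a field, $d\ge1$, $\Lambda=\Bbbk[[x_1,\dots,x_d]]$, $p,q\ge1$ integers, $S=\{s_1,\dots,s_q\}\subset\Lambda^p$ a set of non-zero elements, $\Lambda(S)\subseteq\Lambda^p$ the submodule generated by $S$, and $M=\Lambda^p/\Lambda(S)$. Let $\prec$ be a monomial order over $\mathrm{mon}(\Lambda^p)$ for which $S$ is a standard basis of $\Lambda(S)$. Set $q_0=p$, $q_1=q$, $\prec_0=\prec$, let $\partial_0:\Lambda^{q_0}\to M$ be the canonical projection, let $\partial_1:\Lambda^{q_1}\to\Lambda^{q_0}$ be the homomorphism with $\partial_1(e_{q_1,j})=s_j$ for $1\le j\le q_1$, and let $\mathcal S_0=S$. For $n\ge1$, inductively: (1) let $\mathcal S_n\subset\Lambda^{q_n}$ be a Schreyer family of $\mathcal S_{n-1}=\{\partial_n(e_{q_n,j})\mid 1\le j\le q_n\}$ with respect to $\prec_{n-1}$; (2) let $\prec_n$ be the Schreyer order over $\mathrm{mon}(\Lambda^{q_n})$ induced by $(\mathcal S_{n-1},\prec_{n-1})$; (3) let $q_{n+1}$ be the cardinality of $\mathcal S_n$; (4) let $\partial_{n+1}:\Lambda^{q_{n+1}}\to\Lambda^{q_n}$ be a homomorphism such that $\mathcal S_n=\{\partial_{n+1}(e_{q_{n+1},j})\mid 1\le j\le q_{n+1}\}$. Then, for every $n\ge1$, $\mathcal S_n$ is a standard basis of $\ker(\partial_n)$ with respect to $\prec_n$, and the sequence $$\Lambda^{q_{n+1}}\xrightarrow{\partial_{n+1}}\Lambda^{q_n}\xrightarrow{\partial_n}\cdots\xrightarrow{\partial_1}\Lambda^{q_0}\xrightarrow{\partial_0}M\to0$$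 is exact. Hence this construction yields a free resolution of $M$.
   Context: Monomials of $\Lambda$ are $x^\mu=x_1^{\mu_1}\cdots x_d^{\mu_d}$, $\mu\in\mathbb N^d$; they form the free commutative monoid $[x_1,\dots,x_d]$. A monomial order over $[x_1,\dots,x_d]$ is a total order $\prec$ such that $1\prec x^\mu$ for every $x^\mu\neq 1$, and $x^\mu\prec x^{\mu'}$ implies $x^{\mu+\nu}\prec x^{\mu'+\nu}$ for all $\nu\in\mathbb N^d$. For an integer $r$, let $e_{r,1},\dots,e_{r,r}$ be the canonical basis of $\Lambda^r$ and $\mathrm{mon}(\Lambda^r)=\{x^\mu e_{r,i}\mid \mu\in\mathbb N^d,\ 1\le i\le r\}$. (If some $q_n=0$, then $\Lambda^{q_n}=0$, its set of monomials is empty, and all later $q_m$ are $0$.) A monomial order over $\mathrm{mon}(\Lambda^r)$ is a total order $\prec$ on this set which is compatible with some monomial order, also written $\prec$, over $[x_1,\dots,x_d]$: (i) $x^\mu\prec x^\nu$ implies $x^\mu e_{r,i}\prec x^\nu e_{r,i}$ for every $i$; (ii) $x^\mu e_{r,i}\prec x^{\mu'}e_{r,j}$ implies $x^{\mu+\nu}e_{r,i}\prec x^{\mu'+\nu}e_{r,j}$ for every $\nu\in\mathbb N^d$. For $f\in\Lambda^r$, $\mathrm{supp}(f)$ is the set of monomials having non-zero coefficient in $f$. For $f\ne0$, the leading monomial is the smallest monomial of the support, $\mathrm{lm}(f)=\min_\prec \mathrm{supp}(f)$, and the leading coefficient $\mathrm{lc}(f)\in\Bbbk$ is the coefficient of $\mathrm{lm}(f)$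 in $f$. For $S\subseteq\Lambda^r$, $\mathrm{lm}(S)=\{\mathrm{lm}(f)\mid f\in S\setminus\{0\}\}$. For $T\subseteq\mathrm{mon}(\Lambda^r)$, $\langle T\rangle=\{x^\mu t\mid\mu\in\mathbb N^d,\ t\in T\}$, where $x^\mu\cdot x^\nu e_{r,i}=x^{\mu+\nu}e_{r,i}$. A subset $S$ of a submodule $L\subseteq\Lambda^r$ is a standard basis of $L$ with respect to $\prec$ if $\langle\mathrm{lm}(S)\rangle=\mathrm{lm}(L)$. Let $S=\{s_1,\dots,s_q\}\subset\Lambda^p$ be a set of non-zero elements (enumerated as indicated; for $\mathcal S_{n-1}$ the enumeration is $s_j=\partial_n(e_{q_n,j})$) and $\prec$ a monomial order over $\mathrm{mon}(\Lambda^p)$. Module of syzygies: $\mathrm{syz}^\Lambda(S)=\{(c_1,\dots,c_q)\in\Lambda^q\mid c_1s_1+\cdots+c_qs_q=0\}$. Schreyer order induced by $(S,\prec)$: the order $\prec_{\mathcal S}$ over $\mathrm{mon}(\Lambda^q)$ with $x^\mu e_{q,j}\prec_{\mathcal S}x^{\mu'}e_{q,j'}$ iff $\mathrm{lm}(x^\mu s_j)\prec\mathrm{lm}(x^{\mu'}s_{j'})$, or $\mathrm{lm}(x^\mu s_j)=\mathrm{lm}(x^{\mu'}s_{j'})$ and $j<j'$. It is a monomial order over $\mathrm{mon}(\Lambda^q)$. Overlapping of $S$ with respect to $\prec$: a pair $(s_j,s_{j'})$, $j\ne j'$, such that $\mathrm{lm}(s_j)=x^{\mu_j}e_{p,i}$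 and $\mathrm{lm}(s_{j'})=x^{\mu_{j'}}e_{p,i}$ for the same index $i$. For $\mu,\mu'\in\mathbb N^d$, $\mathrm{lcm}(\mu,\mu')=(\max(\mu_1,\mu'_1),\dots,\max(\mu_d,\mu'_d))$. Schreyer family of $S$ with respect to $\prec$ (where $S$ is a standard basis of the submodule it generates): a set consisting of one element $\mathrm{syz}(s_j,s_{j'})$ for each overlapping $(s_j,s_{j'})$ with $1\le j<j'\le q$, where $\mathrm{syz}(s_j,s_{j'})$ is an element of $\Lambda^q$ of the form $$\frac1{\mathrm{lc}(s_j)}x^{\mathrm{lcm}(\mu_j,\mu_{j'})-\mu_j}e_{q,j}-\frac1{\mathrm{lc}(s_{j'})}x^{\mathrm{lcm}(\mu_j,\mu_{j'})-\mu_{j'}}e_{q,j'}-\sum_{k=1}^qc_ke_{q,k},\qquad (c_1,\dots,c_q)\in\Lambda^q,$$ which is non-zero, belongs to $\mathrm{syz}^\Lambda(S)$, and has leading monomial $x^{\mathrm{lcm}(\mu_j,\mu_{j'})-\mu_j}e_{q,j}$ with respect to $\prec_{\mathcal S}$. (Such an element exists for every overlapping when $S$ is a standard basis.) *)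

theory Defs
  imports
    "HOL-Library.Function_Algebras"
    "HOL-Algebra.AbelCoset"
    "Jordan_Normal_Form.VS_Connect"
begin

section \<open>Formal power series in finitely many variables\<close>

text \<open>
  The variables are indexed by a finite type \<open>'d\<close>, so their number is \<open>CARD('d) \<ge> 1\<close>.  The exponent
  of a monomial is a function \<open>'d \<Rightarrow> nat\<close>, with the pointwise operations.
\<close>

typedef ('d, 'k) mps = "UNIV :: (('d \<Rightarrow> nat) \<Rightarrow> 'k) set"
  morphisms mps_nth Abs_mps ..

setup_lifting type_definition_mps

lemma mps_eqI: "(\<And>\<mu>. mps_nth f \<mu> = mps_nth g \<mu>) \<Longrightarrow> f = g"
  by (simp add: mps_nth_inject[symmetric] ext)

lemma finite_exponent_splittings:
  "finite {(\<alpha>, \<beta>). \<alpha> + \<beta> = (\<mu> :: 'd :: finite \<Rightarrow> nat)}"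
proof -
  have "finite (PiE UNIV (\<lambda>i. {..\<mu> i}))"
    by (rule finite_PiE) simp_all
  moreover have "{(\<alpha>, \<beta>). \<alpha> + \<beta> = \<mu>} \<subseteq>
      PiE UNIV (\<lambda>i. {..\<mu> i}) \<times> PiE UNIV (\<lambda>i. {..\<mu> i})"
    by auto
  ultimately show ?thesis
    by (meson finite_SigmaI finite_subset)
qed

instantiation mps :: (type, zero) zero
begin
lift_definition zero_mps :: "('a, 'b) mps" is "\<lambda>_. 0" .
instance ..
end

instantiation mps :: (type, zero_neq_one) one
begin
lift_definition one_mps :: "('a, 'b) mps" is "\<lambda>\<mu>. if \<mu> = 0 then 1 else 0" .
instance ..
end

instantiation mps :: (type, plus) plus
begin
lift_definition plus_mps :: "('a, 'b) mps \<Rightarrow> ('a, 'b) mps \<Rightarrow> ('a, 'b) mps"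
  is "\<lambda>f g \<mu>. f \<mu> + g \<mu>" .
instance ..
end

instantiation mps :: (type, uminus) uminus
begin
lift_definition uminus_mps :: "('a, 'b) mps \<Rightarrow> ('a, 'b) mps" is "\<lambda>f \<mu>. - f \<mu>" .
instance ..
end

instantiation mps :: (type, minus) minus
begin
lift_definition minus_mps :: "('a, 'b) mps \<Rightarrow> ('a, 'b) mps \<Rightarrow> ('a, 'b) mps"
  is "\<lambda>f g \<mu>. f \<mu> - g \<mu>" .
instance ..
end

instantiation mps :: (finite, comm_semiring_0) times
begin
lift_definition times_mps :: "('a, 'b) mps \<Rightarrow> ('a, 'b) mps \<Rightarrow> ('a, 'b) mps"
  is "\<lambda>f g \<mu>. \<Sum>(\<alpha>, \<beta>) \<in> {(\<alpha>, \<beta>). \<alpha> + \<beta> = \<mu>}. f \<alpha> * g \<beta>" .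
instance ..
end

lemmas mps_nth_simps = zero_mps.rep_eq one_mps.rep_eq plus_mps.rep_eq uminus_mps.rep_eq
  minus_mps.rep_eq

instance mps :: (finite, comm_ring_1) comm_ring_1
proof
  fix a b c :: "('a, 'b) mps"
  show "a + b + c = a + (b + c)" "a + b = b + a" "0 + a = a" "- a + a = 0" "a - b = a + - b"
    by (rule mps_eqI, simp add: mps_nth_simps algebra_simps)+
  show "(0 :: ('a, 'b) mps) \<noteq> 1"
    by (metis mps_nth_simps(1,2) zero_neq_one)
  show "(a + b) * c = a * c + b * c"
    by (rule mps_eqI)
      (simp add: mps_nth_simps times_mps.rep_eq algebra_simps case_prod_unfold sum.distrib)
  show "a * b = b * a"
  proof (rule mps_eqI)
    fix \<mu>
    show "mps_nth (a * b) \<mu> = mps_nth (b * a) \<mu>"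
      unfolding times_mps.rep_eq
      by (rule sum.reindex_bij_witness[where i = prod.swap and j = prod.swap])
        (auto simp: add.commute mult.commute)
  qed
  show "1 * a = a"
  proof (rule mps_eqI)
    fix \<mu> :: "'a \<Rightarrow> nat"
    have "mps_nth (1 * a) \<mu> = (\<Sum>(\<alpha>, \<beta>) \<in> {(0, \<mu>)}. mps_nth (1 :: ('a, 'b) mps) \<alpha> * mps_nth a \<beta>)"
      unfolding times_mps.rep_eq
      by (rule sum.mono_neutral_right)
        (use finite_exponent_splittings[of \<mu>] in \<open>auto simp: one_mps.rep_eq split: if_splits\<close>)
    then show "mps_nth (1 * a) \<mu> = mps_nth a \<mu>"
      by (simp add: one_mps.rep_eq)
  qed
  show "a * b * c = a * (b * c)"
  proof (rule mps_eqI)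
    fix \<mu> :: "'a \<Rightarrow> nat"
    let ?D = "\<lambda>\<mu> :: 'a \<Rightarrow> nat. {(\<alpha>, \<beta>). \<alpha> + \<beta> = \<mu>}"
    have fin: "finite (?D \<nu>)" for \<nu> :: "'a \<Rightarrow> nat"
      by (rule finite_exponent_splittings)
    have "mps_nth (a * b * c) \<mu> = (\<Sum>x\<in>?D \<mu>. \<Sum>y\<in>?D (fst x).
        mps_nth a (fst y) * mps_nth b (snd y) * mps_nth c (snd x))"
      by (simp add: times_mps.rep_eq case_prod_unfold sum_distrib_right)
    also have "\<dots> = (\<Sum>(x, y)\<in>(SIGMA x:?D \<mu>. ?D (fst x)).
        mps_nth a (fst y) * mps_nth b (snd y) * mps_nth c (snd x))"
      using fin by (intro sum.Sigma) auto
    also have "\<dots> = (\<Sum>(x, y)\<in>(SIGMA x:?D \<mu>. ?D (snd x)).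
        mps_nth a (fst x) * (mps_nth b (fst y) * mps_nth c (snd y)))"
      by (rule sum.reindex_bij_witness[where
            i = "\<lambda>((\<alpha>, \<beta>), (\<gamma>, \<delta>)). ((\<alpha> + \<gamma>, \<delta>), (\<alpha>, \<gamma>))" and
            j = "\<lambda>((\<alpha>, \<beta>), (\<gamma>, \<delta>)). ((\<gamma>, \<delta> + \<beta>), (\<delta>, \<beta>))"])
        (auto simp: add.assoc mult.assoc)
    also have "\<dots> = (\<Sum>x\<in>?D \<mu>. \<Sum>y\<in>?D (snd x).
        mps_nth a (fst x) * (mps_nth b (fst y) * mps_nth c (snd y)))"
      using fin by (intro sum.Sigma[symmetric]) auto
    also have "\<dots> = mps_nth (a * (b * c)) \<mu>"
      by (simp add: times_mps.rep_eq case_prod_unfold sum_distrib_left)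
    finally show "mps_nth (a * b * c) \<mu> = mps_nth (a * (b * c)) \<mu>" .
  qed
qed

lift_definition mps_monom :: "('d \<Rightarrow> nat) \<Rightarrow> 'k :: zero \<Rightarrow> ('d, 'k) mps"
  is "\<lambda>\<mu> c \<nu>. if \<nu> = \<mu> then c else 0" .


section \<open>Monomials of free modules and monomial orders\<close>

text \<open>
  The free module of rank \<open>r\<close> has carrier \<open>carrier_vec r\<close>.  Coordinates are numbered from \<open>0\<close>, and the
  monomial \<open>x\<^sup>\<mu> e\<^sub>i\<close> is encoded as the pair \<open>(\<mu>, i)\<close>.
\<close>

abbreviation free_mod ::
  "nat \<Rightarrow> (('d :: finite, 'k :: field) mps, ('d, 'k) mps vec) module" where
  "free_mod r \<equiv> module_vec TYPE(('d, 'k) mps) r"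

type_synonym 'd mono = "('d \<Rightarrow> nat) \<times> nat"

definition mon :: "nat \<Rightarrow> 'd mono set" where
  "mon r = UNIV \<times> {..<r}"

text \<open>All orders are given by their strict part.\<close>

definition exponent_order :: "(('d \<Rightarrow> nat) \<Rightarrow> ('d \<Rightarrow> nat) \<Rightarrow> bool) \<Rightarrow> bool" where
  "exponent_order lt \<longleftrightarrow>
     irreflp lt \<and> transp lt \<and> totalp lt \<and>
     (\<forall>\<mu>. \<mu> \<noteq> 0 \<longrightarrow> lt 0 \<mu>) \<and>
     (\<forall>\<mu> \<mu>' \<nu>. lt \<mu> \<mu>' \<longrightarrow> lt (\<mu> + \<nu>) (\<mu>' + \<nu>))"

definition monomial_order :: "nat \<Rightarrow> ('d mono \<Rightarrow> 'd mono \<Rightarrow> bool) \<Rightarrow> bool" where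
  "monomial_order r lt \<longleftrightarrow>
     irreflp_on (mon r) lt \<and> transp_on (mon r) lt \<and> totalp_on (mon r) lt \<and>
     (\<exists>lt0. exponent_order lt0 \<and>
        (\<forall>\<mu> \<nu>. \<forall>i<r. lt0 \<mu> \<nu> \<longrightarrow> lt (\<mu>, i) (\<nu>, i)) \<and>
        (\<forall>\<mu> \<mu>' \<nu>. \<forall>i<r. \<forall>j<r. lt (\<mu>, i) (\<mu>', j) \<longrightarrow> lt (\<mu> + \<nu>, i) (\<mu>' + \<nu>, j)))"

definition mono_coeff :: "('d, 'k) mps vec \<Rightarrow> 'd mono \<Rightarrow> 'k" where
  "mono_coeff f m = mps_nth (f $ snd m) (fst m)"

definition supp :: "('d, 'k :: zero) mps vec \<Rightarrow> 'd mono set" where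
  "supp f = {m \<in> mon (dim_vec f). mono_coeff f m \<noteq> 0}"

text \<open>The leading monomial is the smallest one; it is unspecified for the zero vector.\<close>

definition lm :: "('d mono \<Rightarrow> 'd mono \<Rightarrow> bool) \<Rightarrow> ('d, 'k :: zero) mps vec \<Rightarrow> 'd mono" where
  "lm lt f = (THE m. m \<in> supp f \<and> (\<forall>m' \<in> supp f. m' \<noteq> m \<longrightarrow> lt m m'))"

definition lc :: "('d mono \<Rightarrow> 'd mono \<Rightarrow> bool) \<Rightarrow> ('d, 'k :: zero) mps vec \<Rightarrow> 'k" where
  "lc lt f = mono_coeff f (lm lt f)"

definition lm_set ::
  "('d mono \<Rightarrow> 'd mono \<Rightarrow> bool) \<Rightarrow> ('d, 'k :: zero) mps vec set \<Rightarrow> 'd mono set" where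
  "lm_set lt S = lm lt ` {f \<in> S. f \<noteq> 0\<^sub>v (dim_vec f)}"

definition mono_multiples :: "'d mono set \<Rightarrow> 'd mono set" where
  "mono_multiples T = {(\<mu> + \<nu>, i) | \<mu> \<nu> i. (\<nu>, i) \<in> T}"

definition standard_basis ::
  "nat \<Rightarrow> ('d mono \<Rightarrow> 'd mono \<Rightarrow> bool) \<Rightarrow> ('d :: finite, 'k :: field) mps vec set \<Rightarrow>
     ('d, 'k) mps vec set \<Rightarrow> bool" where
  "standard_basis r lt L S \<longleftrightarrow>
     submodule class_ring L (free_mod r) \<and> S \<subseteq> L \<and> mono_multiples (lm_set lt S) = lm_set lt L"


section \<open>Schreyer orders and Schreyer families\<close>

text \<open>
  A finite family of elements of the free module of rank \<open>p\<close> is given by its length \<open>q\<close> and its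
  enumeration \<open>s 0, \<dots>, s (q - 1)\<close>.
\<close>

definition syz ::
  "nat \<Rightarrow> nat \<Rightarrow> (nat \<Rightarrow> ('d :: finite, 'k :: field) mps vec) \<Rightarrow> ('d, 'k) mps vec set" where
  "syz p q s =
     {c \<in> carrier_vec q. finsum (free_mod p) (\<lambda>j. c $ j \<cdot>\<^sub>v s j) {..<q} = 0\<^sub>v p}"

definition schreyer_order ::
  "('d mono \<Rightarrow> 'd mono \<Rightarrow> bool) \<Rightarrow> nat \<Rightarrow> (nat \<Rightarrow> ('d :: finite, 'k :: field) mps vec) \<Rightarrow>
     'd mono \<Rightarrow> 'd mono \<Rightarrow> bool" where
  "schreyer_order lt q s m m' \<longleftrightarrow>
     m \<in> mon q \<and> m' \<in> mon q \<and>
     (let (\<mu>, j) = m; (\<mu>', j') = m';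
          l = lm lt (mps_monom \<mu> 1 \<cdot>\<^sub>v s j);
          l' = lm lt (mps_monom \<mu>' 1 \<cdot>\<^sub>v s j')
      in lt l l' \<or> l = l' \<and> j < j')"

definition overlapping ::
  "('d mono \<Rightarrow> 'd mono \<Rightarrow> bool) \<Rightarrow> (nat \<Rightarrow> ('d, 'k :: zero) mps vec) \<Rightarrow> nat \<Rightarrow> nat \<Rightarrow> bool" where
  "overlapping lt s j j' \<longleftrightarrow> j \<noteq> j' \<and> snd (lm lt (s j)) = snd (lm lt (s j'))"

definition exponent_lcm :: "('d \<Rightarrow> nat) \<Rightarrow> ('d \<Rightarrow> nat) \<Rightarrow> 'd \<Rightarrow> nat" where
  "exponent_lcm \<mu> \<mu>' = (\<lambda>i. max (\<mu> i) (\<mu>' i))"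

text \<open>The vector \<open>c\<close> below is the sum of all \<open>c\<^sub>k e\<^sub>k\<close>.\<close>

definition schreyer_syzygy ::
  "('d mono \<Rightarrow> 'd mono \<Rightarrow> bool) \<Rightarrow> nat \<Rightarrow> nat \<Rightarrow> (nat \<Rightarrow> ('d :: finite, 'k :: field) mps vec) \<Rightarrow>
     nat \<Rightarrow> nat \<Rightarrow> ('d, 'k) mps vec \<Rightarrow> bool" where
  "schreyer_syzygy lt p q s j j' \<sigma> \<longleftrightarrow>
     (let \<mu> = fst (lm lt (s j)); \<mu>' = fst (lm lt (s j')); \<kappa> = exponent_lcm \<mu> \<mu>'
      in (\<exists>c \<in> carrier_vec q.
            \<sigma> = mps_monom (\<kappa> - \<mu>) (1 / lc lt (s j)) \<cdot>\<^sub>v unit_vec q j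
                - mps_monom (\<kappa> - \<mu>') (1 / lc lt (s j')) \<cdot>\<^sub>v unit_vec q j' - c) \<and>
         \<sigma> \<noteq> 0\<^sub>v q \<and> \<sigma> \<in> syz p q s \<and>
         lm (schreyer_order lt q s) \<sigma> = (\<kappa> - \<mu>, j))"

definition schreyer_family ::
  "('d mono \<Rightarrow> 'd mono \<Rightarrow> bool) \<Rightarrow> nat \<Rightarrow> nat \<Rightarrow> (nat \<Rightarrow> ('d :: finite, 'k :: field) mps vec) \<Rightarrow>
     ('d, 'k) mps vec set \<Rightarrow> bool" where
  "schreyer_family lt p q s F \<longleftrightarrow>
     (\<exists>\<sigma>. (\<forall>j j'. j < j' \<and> j' < q \<and> overlapping lt s j j' \<longrightarrow>
              schreyer_syzygy lt p q s j j' (\<sigma> j j')) \<and>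
          F = {\<sigma> j j' | j j'. j < j' \<and> j' < q \<and> overlapping lt s j j'})"


section \<open>Quotient modules and free resolutions\<close>

text \<open>The fields \<open>mult\<close> and \<open>one\<close> of a module record carry no meaning.\<close>

definition quotient_module :: "('a, 'b, 'm) module_scheme \<Rightarrow> 'b set \<Rightarrow> ('a, 'b set) module" where
  "quotient_module M N =
     \<lparr>carrier = a_rcosets\<^bsub>M\<^esub> N, mult = undefined, one = undefined, zero = N,
      add = (\<lambda>X Y. X <+>\<^bsub>M\<^esub> Y),
      smult = (\<lambda>a X. \<Union>x\<in>X. N +>\<^bsub>M\<^esub> (a \<odot>\<^bsub>M\<^esub> x))\<rparr>"

definition free_module :: "('a, 'c) ring_scheme \<Rightarrow> ('a, 'b, 'm) module_scheme \<Rightarrow> bool" where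
  "free_module R M \<longleftrightarrow> module R M \<and>
     (\<exists>B \<subseteq> carrier M. \<not> LinearCombinations.module.lin_dep R M B \<and> LinearCombinations.module.span R M B = carrier M)"

text \<open>
  Exactness of \<open>F (n + 1) \<rightarrow> F n \<rightarrow> \<dots> \<rightarrow> F 0 \<rightarrow> M \<rightarrow> 0\<close>, where \<open>\<delta> k : F k \<rightarrow> F (k - 1)\<close> for \<open>k \<ge> 1\<close> and
  \<open>\<epsilon> : F 0 \<rightarrow> M\<close>.
\<close>

definition exact_upto ::
  "nat \<Rightarrow> (nat \<Rightarrow> ('a, 'b) module) \<Rightarrow> (nat \<Rightarrow> 'b \<Rightarrow> 'b) \<Rightarrow> ('b \<Rightarrow> 'c) \<Rightarrow> ('a, 'c) module \<Rightarrow> bool" where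
  "exact_upto n F \<delta> \<epsilon> M \<longleftrightarrow>
     (\<forall>k\<in>{1..n}. mod_hom.im (F (k + 1)) (\<delta> (k + 1)) = mod_hom.ker (F k) (F (k - 1)) (\<delta> k)) \<and>
     mod_hom.im (F 1) (\<delta> 1) = mod_hom.ker (F 0) M \<epsilon> \<and>
     mod_hom.im (F 0) \<epsilon> = carrier M"

definition free_resolution ::
  "('a, 'r) ring_scheme \<Rightarrow> (nat \<Rightarrow> ('a, 'b) module) \<Rightarrow> (nat \<Rightarrow> 'b \<Rightarrow> 'b) \<Rightarrow> ('b \<Rightarrow> 'c) \<Rightarrow>
     ('a, 'c) module \<Rightarrow> bool" where
  "free_resolution R F \<delta> \<epsilon> M \<longleftrightarrow>
     (\<forall>n. free_module R (F n)) \<and>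
     (\<forall>n\<ge>1. mod_hom R (F n) (F (n - 1)) (\<delta> n)) \<and>
     mod_hom R (F 0) M \<epsilon> \<and>
     (\<forall>n. exact_upto n F \<delta> \<epsilon> M)"

end

theory Submission
  imports Defs
begin

text \<open>
  If \<open>\<Sum> c\<^sub>k s\<^sub>k = 0\<close> and \<open>x\<^sup>\<mu> e\<^sub>j\<close> is the leading monomial of \<open>c\<close> for the Schreyer order, then the leading
  term of \<open>x\<^sup>\<mu> s\<^sub>j\<close> cancels against that of some \<open>x\<^sup>\<nu> s\<^sub>k\<close> with \<open>k > j\<close>.  Hence \<open>(s\<^sub>j, s\<^sub>k)\<close> is an overlapping
  and \<open>x\<^sup>\<mu> e\<^sub>j\<close> is a multiple of the leading monomial of its Schreyer syzygy, so the Schreyer family is a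
  standard basis of the syzygies.  A standard basis generates, by a division that determines
  coefficients recursively along the order, which is a well-order by Dickson's lemma.  So the image of
  each differential is the kernel of the previous one.
\<close>

section \<open>Monomial orders\<close>

lemma nat_seq_incseq_subseq:
  fixes f :: "nat \<Rightarrow> nat"
  obtains h where "strict_mono h" "incseq (\<lambda>n. f (h n))"
proof -
  obtain h where h: "strict_mono (h :: nat \<Rightarrow> nat)" "monoseq (\<lambda>n. f (h n))"
    using seq_monosub[of f] by blast
  show thesis
  proof (cases "incseq (\<lambda>n. f (h n))")
    case False
    with h(2) have dec: "decseq (\<lambda>n. f (h n))"
      by (auto simp: monoseq_iff)
    \<comment> \<open>A decreasing sequence of naturals stays at its least value once it is
      attained, so the tail from \<open>N\<close> on is constant, hence increasing.\<close>
    define b where "b = (LEAST b. b \<in> range (\<lambda>n. f (h n)))"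
    have "b \<in> range (\<lambda>n. f (h n))"
      unfolding b_def by (rule LeastI[of _ "f (h 0)"]) simp
    then obtain N where N: "b = f (h N)" by auto
    have "f (h (n + N)) = b" for n
      using decseqD[OF dec, of N "n + N"] Least_le[of "\<lambda>b. b \<in> range (\<lambda>n. f (h n))" "f (h (n + N))"]
      by (simp add: N b_def[symmetric])
    moreover have "strict_mono (\<lambda>n. h (n + N))"
      using h(1) by (simp add: strict_mono_def)
    ultimately show thesis
      using that[of "\<lambda>n. h (n + N)"] by (simp add: incseq_def)
  qed (use h that in blast)
qed

text \<open>Coordinates are treated one at a time: thinning out an increasing sequence leaves it
  increasing, so each further choice keeps what was achieved before.\<close>

lemma common_incseq_subseq:
  fixes f :: "nat \<Rightarrow> 'a \<Rightarrow> nat"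
  assumes "finite D"
  shows "\<exists>h. strict_mono h \<and> (\<forall>x\<in>D. incseq (\<lambda>n. f (h n) x))"
  using assms
proof (induction D rule: finite_induct)
  case empty
  show ?case using strict_mono_id by auto
next
  case (insert x D)
  then obtain h where h: "strict_mono h" "\<forall>x\<in>D. incseq (\<lambda>n. f (h n) x)" by blast
  obtain g where g: "strict_mono g" "incseq (\<lambda>n. f (h (g n)) x)"
    by (rule nat_seq_incseq_subseq)
  have "incseq (\<lambda>n. f (h (g n)) y)" if "y \<in> D" for y
    using h(2) that strict_mono_mono[OF g(1)] by (auto simp: incseq_def mono_def)
  with g h(1) show ?case
    by (intro exI[of _ "\<lambda>n. h (g n)"]) (auto simp: strict_mono_def)
qed

text \<open>Along a subsequence on which all exponents increase and the position is constant, the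
  first monomial divides the second.\<close>

lemma dickson_mono:
  fixes f :: "nat \<Rightarrow> ('d :: finite) mono"
  assumes "\<And>n. f n \<in> mon r"
  obtains i j where "i < j" "snd (f i) = snd (f j)" "fst (f i) \<le> fst (f j)"
proof -
  \<comment> \<open>The two \<open>Inr\<close> coordinates make the position both increasing and decreasing, hence constant.\<close>
  define g where "g = (\<lambda>n. case_sum (fst (f n)) (\<lambda>b. if b then snd (f n) else r - snd (f n)))"
  obtain h where h: "strict_mono h" "\<And>x. incseq (\<lambda>n. g (h n) x)"
    using common_incseq_subseq[of UNIV g] by auto
  have le: "g (h 0) x \<le> g (h 1) x" for x
    using h(2)[of x] by (simp add: incseq_def)
  have "fst (f (h 0)) \<le> fst (f (h 1))"
    using le[of "Inl _"] by (simp add: g_def le_fun_def)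
  moreover have "snd (f (h 0)) = snd (f (h 1))"
    using le[of "Inr True"] le[of "Inr False"] assms[of "h 0"] assms[of "h 1"]
    by (auto simp: g_def mon_def)
  moreover have "h 0 < h 1"
    using h(1) by (simp add: strict_mono_def)
  ultimately show thesis using that by blast
qed

section \<open>Well-foundedness and leading monomials\<close>

locale ordered_monomials =
  fixes r :: nat and lt :: "('d :: finite) mono \<Rightarrow> 'd mono \<Rightarrow> bool"
  assumes monomial_order: "monomial_order r lt"
begin

lemma lt_irrefl: "m \<in> mon r \<Longrightarrow> \<not> lt m m"
  using monomial_order by (auto simp: monomial_order_def dest: irreflp_onD)

lemma lt_trans: "lt a b \<Longrightarrow> lt b c \<Longrightarrow> a \<in> mon r \<Longrightarrow> b \<in> mon r \<Longrightarrow> c \<in> mon r \<Longrightarrow> lt a c"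
  using monomial_order by (auto simp: monomial_order_def dest: transp_onD)

lemma lt_total: "a \<noteq> b \<Longrightarrow> a \<in> mon r \<Longrightarrow> b \<in> mon r \<Longrightarrow> lt a b \<or> lt b a"
  using monomial_order by (auto simp: monomial_order_def dest: totalp_onD)

lemma lt_shift: "lt (\<mu>, i) (\<mu>', j) \<Longrightarrow> i < r \<Longrightarrow> j < r \<Longrightarrow> lt (\<mu> + \<nu>, i) (\<mu>' + \<nu>, j)"
  using monomial_order by (auto simp: monomial_order_def)

text \<open>The exponent \<open>\<nu> - \<mu>\<close> is nonzero and so lies above \<open>0\<close>;
  adding \<open>\<mu>\<close> keeps this, and compatibility carries it to the position
  \<open>i\<close>.\<close>

lemma dvd_imp_lt:
  assumes "\<mu> \<le> \<nu>" "\<mu> \<noteq> \<nu>" "i < r"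
  shows "lt (\<mu>, i) (\<nu>, i)"
proof -
  obtain lt0 where lt0: "exponent_order lt0"
    "\<And>\<mu> \<nu> i. i < r \<Longrightarrow> lt0 \<mu> \<nu> \<Longrightarrow> lt (\<mu>, i) (\<nu>, i)"
    using monomial_order by (auto simp: monomial_order_def)
  have split: "\<nu> = (\<nu> - \<mu>) + \<mu>"
    using assms(1) by (auto simp: le_fun_def)
  have "\<nu> - \<mu> \<noteq> 0"
    using split assms(2) by (metis add_0)
  then have "lt0 (0 + \<mu>) ((\<nu> - \<mu>) + \<mu>)"
    using lt0(1) unfolding exponent_order_def by blast
  with lt0(2) assms(3) split show ?thesis by simp
qed

text \<open>An infinite descending chain would contain a monomial dividing a later one, which then
  cannot be smaller. This gives power series, whose supports may be infinite, a leading monomial,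
  and it carries the recursion in \<open>standard_basis_generates\<close>.\<close>

lemma wf_lt: "wf {(m, m'). m \<in> mon r \<and> m' \<in> mon r \<and> lt m m'}"
  unfolding wf_iff_no_infinite_down_chain
proof
  assume "\<exists>f. \<forall>i. (f (Suc i), f i) \<in> {(m, m'). m \<in> mon r \<and> m' \<in> mon r \<and> lt m m'}"
  then obtain f where f: "\<And>i. f i \<in> mon r" "\<And>i. lt (f (Suc i)) (f i)"
    by auto
  have desc: "lt (f j) (f i)" if "i < j" for i j
    using that by (induction rule: strict_inc_induct) (blast intro: f lt_trans)+
  obtain i j where ij: "i < j" "snd (f i) = snd (f j)" "fst (f i) \<le> fst (f j)"
    using dickson_mono f(1) by blast
  have "f i = f j \<or> lt (f i) (f j)"
    using dvd_imp_lt[of "fst (f i)" "fst (f j)" "snd (f i)"] ij f(1)[of i]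
    by (cases "f i"; cases "f j") (auto simp: mon_def)
  then show False
    using desc[OF ij(1)] lt_trans lt_irrefl f(1) by metis
qed

lemma supp_subset: "f \<in> carrier_vec r \<Longrightarrow> supp f \<subseteq> mon r"
  by (auto simp: supp_def)

lemma lm_eqI:
  assumes "f \<in> carrier_vec r" "m \<in> supp f" "\<And>m'. m' \<in> supp f \<Longrightarrow> m' \<noteq> m \<Longrightarrow> lt m m'"
  shows "lm lt f = m"
  unfolding lm_def
proof (rule the_equality)
  fix m' assume m': "m' \<in> supp f \<and> (\<forall>m''\<in>supp f. m'' \<noteq> m' \<longrightarrow> lt m' m'')"
  then show "m' = m"
    using assms lt_trans lt_irrefl supp_subset[OF assms(1)] by (metis subsetD)
qed (use assms in blast)

text \<open>A nonzero vector has nonempty support. Well-foundedness gives a minimal element,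
  totality makes it the minimum, and so the description in \<open>lm\<close> denotes it.\<close>

lemma lm_least:
  assumes "f \<in> carrier_vec r" "f \<noteq> 0\<^sub>v r"
  shows "lm lt f \<in> supp f" and "\<And>m. m \<in> supp f \<Longrightarrow> m \<noteq> lm lt f \<Longrightarrow> lt (lm lt f) m"
proof -
  have "supp f \<noteq> {}"
  proof
    assume "supp f = {}"
    then have "f $ i = 0" if "i < r" for i
      using assms(1) that by (intro mps_eqI) (auto simp: supp_def mon_def mono_coeff_def zero_mps.rep_eq)
    then show False using assms by auto
  qed
  then obtain m where m: "m \<in> supp f" "\<And>y. (y, m) \<in> {(m, m'). m \<in> mon r \<and> m' \<in> mon r \<and> lt m m'} \<Longrightarrow> y \<notin> supp f"
    using wf_lt unfolding wf_eq_minimal by blast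
  have least: "lt m m'" if "m' \<in> supp f" "m' \<noteq> m" for m'
    using m that lt_total supp_subset[OF assms(1)] by blast
  have "lm lt f = m" using lm_eqI assms(1) m(1) least by blast
  then show "lm lt f \<in> supp f" "\<And>m. m \<in> supp f \<Longrightarrow> m \<noteq> lm lt f \<Longrightarrow> lt (lm lt f) m"
    using m least by auto
qed

lemma snd_lm_less:
  assumes "f \<in> carrier_vec r" "f \<noteq> 0\<^sub>v r"
  shows "snd (lm lt f) < r"
  using lm_least(1)[OF assms] supp_subset[OF assms(1)] by (auto simp: mon_def)

lemma lc_nonzero:
  assumes "f \<in> carrier_vec r" "f \<noteq> 0\<^sub>v r"
  shows "lc lt f \<noteq> 0"
  using lm_least(1)[OF assms] by (auto simp: lc_def supp_def)

end

section \<open>Multiplication by monomials\<close>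

lemma mps_nth_monom_mult:
  fixes g :: "('d :: finite, 'k :: comm_ring_1) mps"
  shows "mps_nth (mps_monom \<nu> c * g) \<mu> = (if \<nu> \<le> \<mu> then c * mps_nth g (\<mu> - \<nu>) else 0)"
proof -
  \<comment> \<open>Subtraction of exponents truncates, hence the condition
    \<open>\<nu> \<le> \<mu>\<close>; under it a single splitting meets the only coefficient of the
    monomial.\<close>
  have *: "\<nu> + \<beta> = \<mu> \<longleftrightarrow> \<nu> \<le> \<mu> \<and> \<beta> = \<mu> - \<nu>" for \<beta>
    by (auto simp: le_fun_def fun_eq_iff) (metis le_add1, metis add_diff_cancel_left')
  have "mps_nth (mps_monom \<nu> c * g) \<mu> =
      (\<Sum>(\<alpha>, \<beta>)\<in>(if \<nu> \<le> \<mu> then {(\<nu>, \<mu> - \<nu>)} else {}). mps_nth (mps_monom \<nu> c) \<alpha> * mps_nth g \<beta>)"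
    unfolding times_mps.rep_eq
    by (rule sum.mono_neutral_right)
      (use finite_exponent_splittings[of \<mu>] in
        \<open>auto simp: mps_monom.rep_eq * split: if_splits\<close>)
  then show ?thesis by (simp add: mps_monom.rep_eq)
qed

lemma mono_coeff_monom_smult:
  fixes f :: "('d :: finite, 'k :: comm_ring_1) mps vec"
  assumes "i < dim_vec f"
  shows "mono_coeff (mps_monom \<nu> c \<cdot>\<^sub>v f) (\<mu>, i) = (if \<nu> \<le> \<mu> then c * mono_coeff f (\<mu> - \<nu>, i) else 0)"
  using assms by (simp add: mono_coeff_def mps_nth_monom_mult)

text \<open>The support is translated by \<open>\<nu>\<close>, and translation preserves the order,
  so the least element goes to its translate.\<close>

lemma (in ordered_monomials) lm_monom_smult:
  fixes f :: "('d, 'k :: field) mps vec"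
  assumes f: "f \<in> carrier_vec r" "f \<noteq> 0\<^sub>v r"
  shows "lm lt (mps_monom \<nu> 1 \<cdot>\<^sub>v f) = (\<nu> + fst (lm lt f), snd (lm lt f))"
    and "mps_monom \<nu> 1 \<cdot>\<^sub>v f \<noteq> 0\<^sub>v r"
proof -
  let ?g = "mps_monom \<nu> 1 \<cdot>\<^sub>v f" and ?m = "(\<nu> + fst (lm lt f), snd (lm lt f))"
  have supp: "(\<mu>, i) \<in> supp ?g \<longleftrightarrow> \<nu> \<le> \<mu> \<and> (\<mu> - \<nu>, i) \<in> supp f" for \<mu> i
    by (auto simp: supp_def mon_def mono_coeff_monom_smult split: if_splits)
  have m: "?m \<in> supp ?g"
    using lm_least(1)[OF f] by (simp add: supp le_fun_def)
  have "lt ?m (\<mu>, i)" if "(\<mu>, i) \<in> supp ?g" "(\<mu>, i) \<noteq> ?m" for \<mu> i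
  proof -
    from that have *: "\<nu> \<le> \<mu>" "(\<mu> - \<nu>, i) \<in> supp f" by (auto simp: supp)
    then have \<mu>: "\<mu> = \<mu> - \<nu> + \<nu>" by (auto simp: le_fun_def)
    have "(\<mu> - \<nu>, i) \<noteq> lm lt f"
      using that(2) \<mu> by (metis add.commute fst_conv snd_conv)
    then have "lt (lm lt f) (\<mu> - \<nu>, i)"
      using lm_least(2)[OF f *(2)] by blast
    from lt_shift[of "fst (lm lt f)" "snd (lm lt f)" "\<mu> - \<nu>" i \<nu>] this snd_lm_less[OF f]
      supp_subset[OF f(1)] * \<mu> show ?thesis
      by (auto simp: mon_def add.commute)
  qed
  with m show "lm lt ?g = ?m"
    by (intro lm_eqI) (use f in auto)
  from m snd_lm_less[OF f] show "?g \<noteq> 0\<^sub>v r"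
    by (auto simp: supp_def mon_def mono_coeff_def zero_mps.rep_eq)
qed

text \<open>The easy half of being a standard basis: \<open>L\<close> is closed under multiplication
  by monomials, which shifts leading monomials.\<close>

lemma (in ordered_monomials) mono_multiples_lm_set_subset:
  assumes "submodule class_ring L (free_mod r)" "S \<subseteq> L"
  shows "mono_multiples (lm_set lt S) \<subseteq> lm_set lt L"
proof
  fix m assume "m \<in> mono_multiples (lm_set lt S)"
  then obtain \<mu> f where f: "f \<in> S" "f \<noteq> 0\<^sub>v (dim_vec f)"
    and m: "m = (\<mu> + fst (lm lt f), snd (lm lt f))"
    by (fastforce simp: mono_multiples_def lm_set_def dest: sym[of "(_, _)" "lm _ _"])
  have L: "L \<subseteq> carrier_vec r" "\<And>c v. v \<in> L \<Longrightarrow> c \<cdot>\<^sub>v v \<in> L"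
    using assms(1) by (auto simp: LinearCombinations.submodule_def module_vec_simps)
  have fr: "f \<in> carrier_vec r" "f \<noteq> 0\<^sub>v r"
    using f L assms(2) by auto
  show "m \<in> lm_set lt L"
    unfolding lm_set_def
    using lm_monom_smult[OF fr, of \<mu>] m f(1) assms(2) L(2) fr(1)
    by (intro image_eqI[of _ _ "mps_monom \<mu> 1 \<cdot>\<^sub>v f"]) auto
qed

section \<open>Combinations of a finite family\<close>

lemma module_free_mod: "module class_ring (free_mod r)"
proof -
  interpret vec_module "TYPE(('a, 'b) mps)" r .
  show ?thesis by unfold_locales
qed

abbreviation combination ::
  "nat \<Rightarrow> nat \<Rightarrow> (nat \<Rightarrow> ('d :: finite, 'k :: field) mps vec) \<Rightarrow> ('d, 'k) mps vec \<Rightarrow> ('d, 'k) mps vec" where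
  "combination p q s c \<equiv> finsum (free_mod p) (\<lambda>j. c $ j \<cdot>\<^sub>v s j) {..<q}"

text \<open>Turns the abstract module sum into sums of power series in each coordinate. Both claims
  go through one induction, since the second needs the first.\<close>

lemma finsum_free_mod:
  fixes f :: "'b \<Rightarrow> ('d :: finite, 'k :: field) mps vec"
  assumes "finite A" "f \<in> A \<rightarrow> carrier_vec p"
  shows "finsum (free_mod p) f A \<in> carrier_vec p"
    and "i < p \<Longrightarrow> finsum (free_mod p) f A $ i = (\<Sum>a\<in>A. f a $ i)"
proof -
  interpret vec_module "TYPE(('d, 'k) mps)" p .
  have "finsum (free_mod p) f A \<in> carrier_vec p \<and>
    (i < p \<longrightarrow> finsum (free_mod p) f A $ i = (\<Sum>a\<in>A. f a $ i))" for i
    using assms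
  proof (induction A rule: finite_induct)
    case empty
    then show ?case by (simp add: module_vec_simps)
  next
    case (insert a A)
    then have "finsum (free_mod p) f (insert a A) = f a + finsum (free_mod p) f A"
      by (subst finsum_insert) (auto simp: module_vec_simps)
    moreover have "finsum (free_mod p) f A \<in> carrier_vec p" "f a \<in> carrier_vec p"
      and "i < p \<longrightarrow> finsum (free_mod p) f A $ i = (\<Sum>a\<in>A. f a $ i)"
      using insert by blast+
    ultimately show ?case
      using insert.hyps index_add_vec(1)[of i "finsum (free_mod p) f A" "f a"]
      by (auto simp del: index_add_vec(1) dest: carrier_vecD)
  qed
  then show "finsum (free_mod p) f A \<in> carrier_vec p"
    and "i < p \<Longrightarrow> finsum (free_mod p) f A $ i = (\<Sum>a\<in>A. f a $ i)"
    by auto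
qed

lemma combination_carrier:
  assumes "\<forall>j<q. s j \<in> carrier_vec p"
  shows "combination p q s c \<in> carrier_vec p"
  using assms by (intro finsum_free_mod) auto

lemma combination_Suc:
  assumes "\<forall>j<Suc n. s j \<in> carrier_vec p"
  shows "combination p (Suc n) s c = c $ n \<cdot>\<^sub>v s n + combination p n s c"
proof -
  interpret vec_module "TYPE(('a, 'b) mps)" p .
  show ?thesis
    unfolding lessThan_Suc using assms
    by (subst finsum_insert) (auto simp: module_vec_simps)
qed

lemma combination_index:
  assumes "\<forall>j<q. s j \<in> carrier_vec p" "i < p"
  shows "combination p q s c $ i = (\<Sum>j<q. c $ j * s j $ i)"
  using assms by (subst finsum_free_mod(2)) (auto intro!: sum.cong)

lemma mps_nth_sum: "mps_nth (\<Sum>a\<in>A. f a) \<mu> = (\<Sum>a\<in>A. mps_nth (f a) \<mu>)"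
  for f :: "'a \<Rightarrow> ('d :: finite, 'k :: comm_ring_1) mps"
  by (induction A rule: infinite_finite_induct) (simp_all add: mps_nth_simps)

lemma mono_coeff_combination:
  assumes "\<forall>j<q. s j \<in> carrier_vec p" "i < p"
  shows "mono_coeff (combination p q s c) (\<kappa>, i) =
    (\<Sum>j<q. \<Sum>(\<alpha>, \<beta>)\<in>{(\<alpha>, \<beta>). \<alpha> + \<beta> = \<kappa>}. mono_coeff c (\<alpha>, j) * mono_coeff (s j) (\<beta>, i))"
  by (simp add: mono_coeff_def combination_index[OF assms] mps_nth_sum times_mps.rep_eq)

lemma unit_vec_combination:
  fixes v :: "('d :: finite, 'k :: field) mps vec"
  assumes "v \<in> carrier_vec q"
  shows "v = combination q q (unit_vec q) v"
proof (rule eq_vecI)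
  fix i assume "i < dim_vec (combination q q (unit_vec q) v)"
  moreover have "dim_vec (combination q q (unit_vec q) v) = q"
    using combination_carrier[of q "unit_vec q" q v] by auto
  ultimately have i: "i < q" by simp
  then have "combination q q (unit_vec q) v $ i = (\<Sum>j<q. v $ j * (if i = j then 1 else 0))"
    by (subst combination_index) (auto intro!: sum.cong)
  also have "\<dots> = v $ i"
    using i by (simp add: if_distrib cong: if_cong)
  finally show "v $ i = combination q q (unit_vec q) v $ i" by simp
qed (use assms combination_carrier[of q "unit_vec q" q v] in auto)

section \<open>Homomorphisms of free modules, their kernels and images\<close>

lemma mod_hom_combination:
  fixes f :: "('d :: finite, 'k :: field) mps vec \<Rightarrow> ('d, 'k) mps vec"
  assumes "mod_hom class_ring (free_mod q) (free_mod p) f" "\<forall>j<n. s j \<in> carrier_vec q"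
  shows "f (combination q n s c) = combination p n (\<lambda>j. f (s j)) c"
proof -
  interpret f: mod_hom class_ring "free_mod q" "free_mod p" f by fact
  \<comment> \<open>Membership in the carrier is carried along because \<open>f\<close> is additive
    on the carrier only.\<close>
  have "f (combination q n s c) = combination p n (\<lambda>j. f (s j)) c \<and>
     combination q n s c \<in> carrier_vec q"
    using assms(2)
  proof (induction n)
    case 0
    show ?case using f.f0_is_0 by (simp add: module_vec_simps)
  next
    case (Suc n)
    have s: "\<forall>j<n. f (s j) \<in> carrier_vec p" "f (s n) \<in> carrier_vec p"
      using Suc.prems f.f_im by (auto simp: module_vec_simps)
    have "combination q (Suc n) s c = c $ n \<cdot>\<^sub>v s n + combination q n s c"
      using Suc.prems by (rule combination_Suc)
    moreover have "combination p (Suc n) (\<lambda>j. f (s j)) c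
        = c $ n \<cdot>\<^sub>v f (s n) + combination p n (\<lambda>j. f (s j)) c"
      using s by (intro combination_Suc) (auto simp: less_Suc_eq)
    moreover have "f (c $ n \<cdot>\<^sub>v s n + combination q n s c) = c $ n \<cdot>\<^sub>v f (s n) + f (combination q n s c)"
      using Suc f.f_add[of "c $ n \<cdot>\<^sub>v s n" "combination q n s c"] f.f_smult[of "c $ n" "s n"]
      by (simp add: module_vec_simps)
    ultimately show ?case using Suc by simp
  qed
  then show ?thesis by blast
qed

lemma mod_hom_eq_combination:
  assumes "mod_hom class_ring (free_mod q) (free_mod p) f" "v \<in> carrier_vec q"
  shows "f v = combination p q (\<lambda>j. f (unit_vec q j)) v"
  using mod_hom_combination[OF assms(1), of q "unit_vec q" v] unit_vec_combination[OF assms(2)] by simp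

lemma mod_hom_unit_vec_carrier:
  assumes "mod_hom class_ring (free_mod q) (free_mod p) f"
  shows "f (unit_vec q j) \<in> carrier_vec p"
proof -
  interpret mod_hom class_ring "free_mod q" "free_mod p" f by fact
  show ?thesis using f_im[of "unit_vec q j"] by (simp add: module_vec_simps)
qed

text \<open>\<open>f\<close> sends a vector to the combination of the images of the unit vectors
  with its entries as coefficients, so it vanishes exactly on their relations.\<close>

lemma syz_eq_ker:
  assumes "mod_hom class_ring (free_mod q) (free_mod p) f"
  shows "syz p q (\<lambda>j. f (unit_vec q j)) = mod_hom.ker (free_mod q) (free_mod p) f"
  using mod_hom_eq_combination[OF assms, symmetric]
  by (auto simp: syz_def mod_hom.ker_def[OF assms] module_vec_simps)

lemma combination_in_submodule:
  fixes s :: "nat \<Rightarrow> ('d :: finite, 'k :: field) mps vec"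
  assumes "submodule class_ring L (free_mod p)" "\<forall>j<q. s j \<in> L"
  shows "combination p q s c \<in> L"
  using assms(2)
proof (induction q)
  interpret vec_module "TYPE(('d, 'k) mps)" p .
  case 0
  show ?case using assms(1) by (simp add: LinearCombinations.submodule_def module_vec_simps)
next
  case (Suc q)
  have L: "L \<subseteq> carrier_vec p" "\<And>v w. v \<in> L \<Longrightarrow> w \<in> L \<Longrightarrow> v + w \<in> L" "\<And>c v. v \<in> L \<Longrightarrow> c \<cdot>\<^sub>v v \<in> L"
    using assms(1) by (auto simp: LinearCombinations.submodule_def module_vec_simps)
  have "combination p (Suc q) s c = c $ q \<cdot>\<^sub>v s q + combination p q s c"
    using Suc.prems L(1) by (intro combination_Suc) auto
  with Suc L show ?case by simp
qed

text \<open>Each value of \<open>f\<close> is a combination of the images of the unit vectors;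
  conversely the image is a submodule containing them.\<close>

lemma im_eq_span:
  assumes "mod_hom class_ring (free_mod q) (free_mod p) f"
  shows "mod_hom.im (free_mod q) f =
    LinearCombinations.module.span class_ring (free_mod p) ((\<lambda>j. f (unit_vec q j)) ` {..<q})"
proof (intro equalityI subsetI)
  let ?S = "(\<lambda>j. f (unit_vec q j)) ` {..<q}"
  have S: "?S \<subseteq> carrier (free_mod p)"
    using mod_hom_unit_vec_carrier[OF assms] by (auto simp: module_vec_simps)
  fix w assume "w \<in> mod_hom.im (free_mod q) f"
  then obtain v where "v \<in> carrier_vec q" "w = f v"
    by (auto simp: mod_hom.im_def[OF assms] module_vec_simps)
  then show "w \<in> LinearCombinations.module.span class_ring (free_mod p) ?S"
    using LinearCombinations.module.in_own_span[OF module_free_mod S]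
    by (subst \<open>w = f v\<close>, subst mod_hom_eq_combination[OF assms])
      (auto intro!: combination_in_submodule LinearCombinations.module.span_is_submodule
        module_free_mod S)
next
  fix w assume "w \<in> LinearCombinations.module.span class_ring (free_mod p) ((\<lambda>j. f (unit_vec q j)) ` {..<q})"
  moreover have "(\<lambda>j. f (unit_vec q j)) ` {..<q} \<subseteq> mod_hom.im (free_mod q) f"
    by (auto simp: mod_hom.im_def[OF assms] module_vec_simps)
  ultimately show "w \<in> mod_hom.im (free_mod q) f"
    using LinearCombinations.module.span_is_subset[OF module_free_mod _ mod_hom.im_is_submodule[OF assms]]
    by blast
qed

section \<open>Schreyer families and division\<close>

text \<open>One stage of the resolution. \<open>q = 0\<close> is allowed, which covers the stages
  after the modules have become zero.\<close>

locale ordered_family = ordered_monomials p lt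
  for p :: nat and lt :: "('d :: finite) mono \<Rightarrow> 'd mono \<Rightarrow> bool" +
  fixes q :: nat and s :: "nat \<Rightarrow> ('d, 'k :: field) mps vec"
  assumes carrier: "j < q \<Longrightarrow> s j \<in> carrier_vec p"
    and nonzero: "j < q \<Longrightarrow> s j \<noteq> 0\<^sub>v p"
begin

text \<open>For \<open>k < q\<close> this is the leading monomial of \<open>x^\<nu> s k\<close>, by
  \<open>lm_monom_smult\<close>.\<close>

abbreviation lead :: "('d \<Rightarrow> nat) \<Rightarrow> nat \<Rightarrow> 'd mono" where
  "lead \<nu> k \<equiv> (\<nu> + fst (lm lt (s k)), snd (lm lt (s k)))"

lemma lead_in_mon: "k < q \<Longrightarrow> lead \<nu> k \<in> mon p"
  using snd_lm_less[OF carrier nonzero] by (simp add: mon_def)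

lemma lead_shift:
  assumes "lt (lead \<mu> j) (lead \<mu>' k)" "j < q" "k < q"
  shows "lt (lead (\<mu> + \<nu>) j) (lead (\<mu>' + \<nu>) k)"
  using lt_shift[OF assms(1), of \<nu>] snd_lm_less[OF carrier nonzero] assms(2,3)
  by (simp add: ac_simps)

text \<open>If a non-leading monomial of \<open>s k\<close> contributed at
  \<open>(\<kappa>, i)\<close>, the term of \<open>c\<close> multiplying it would have a lead below
  \<open>(\<kappa>, i)\<close>. So only leading terms contribute, at most one for each
  \<open>k\<close>. This serves both the cancellation in syzygies and the division.\<close>

lemma mono_coeff_combination_lead:
  assumes "i < p" and not_less: "\<And>\<nu> k. k < q \<Longrightarrow> mono_coeff c (\<nu>, k) \<noteq> 0 \<Longrightarrow> \<not> lt (lead \<nu> k) (\<kappa>, i)"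
  shows "mono_coeff (combination p q s c) (\<kappa>, i) =
    (\<Sum>k<q. if snd (lm lt (s k)) = i \<and> fst (lm lt (s k)) \<le> \<kappa>
       then mono_coeff c (\<kappa> - fst (lm lt (s k)), k) * lc lt (s k) else 0)"
proof -
  have "(\<Sum>(\<alpha>, \<beta>)\<in>{(\<alpha>, \<beta>). \<alpha> + \<beta> = \<kappa>}. mono_coeff c (\<alpha>, k) * mono_coeff (s k) (\<beta>, i)) =
      (if snd (lm lt (s k)) = i \<and> fst (lm lt (s k)) \<le> \<kappa>
       then mono_coeff c (\<kappa> - fst (lm lt (s k)), k) * lc lt (s k) else 0)" if k: "k < q" for k
  proof -
    let ?b = "fst (lm lt (s k))"
    \<comment> \<open>The only splitting that can contribute; there is none if the leading monomial
      has another position or does not divide.\<close>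
    let ?A = "if snd (lm lt (s k)) = i \<and> ?b \<le> \<kappa> then {(\<kappa> - ?b, ?b)} else {}"
    have only_lm: "(\<beta>, i) = lm lt (s k)"
      if "\<alpha> + \<beta> = \<kappa>" "mono_coeff c (\<alpha>, k) \<noteq> 0" "mono_coeff (s k) (\<beta>, i) \<noteq> 0" for \<alpha> \<beta>
    proof (rule ccontr)
      assume "(\<beta>, i) \<noteq> lm lt (s k)"
      moreover have "(\<beta>, i) \<in> supp (s k)"
        using that(3) carrier[OF k] assms(1) by (simp add: supp_def mon_def)
      ultimately have "lt (fst (lm lt (s k)), snd (lm lt (s k))) (\<beta>, i)"
        using lm_least(2)[OF carrier[OF k] nonzero[OF k]] by simp
      from lt_shift[OF this, of \<alpha>] have "lt (lead \<alpha> k) (\<kappa>, i)"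
        using snd_lm_less[OF carrier[OF k] nonzero[OF k]] assms(1) that(1) by (simp add: add.commute)
      then show False using not_less[OF k that(2)] by simp
    qed
    have sub: "?A \<subseteq> {(\<alpha>, \<beta>). \<alpha> + \<beta> = \<kappa>}"
      by (auto simp: le_fun_def)
    have zero: "mono_coeff c (\<alpha>, k) * mono_coeff (s k) (\<beta>, i) = 0"
      if "\<alpha> + \<beta> = \<kappa>" "(\<alpha>, \<beta>) \<notin> ?A" for \<alpha> \<beta>
    proof (rule ccontr)
      assume "\<not> ?thesis"
      then have lm: "lm lt (s k) = (\<beta>, i)" using only_lm[OF that(1)] by simp
      have "\<beta> \<le> \<kappa>" "\<alpha> = \<kappa> - \<beta>" using that(1) by (auto simp: le_fun_def)
      with lm that(2) show False by simp
    qed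
    have "(\<Sum>(\<alpha>, \<beta>)\<in>{(\<alpha>, \<beta>). \<alpha> + \<beta> = \<kappa>}. mono_coeff c (\<alpha>, k) * mono_coeff (s k) (\<beta>, i)) =
        (\<Sum>(\<alpha>, \<beta>)\<in>?A. mono_coeff c (\<alpha>, k) * mono_coeff (s k) (\<beta>, i))"
    proof (intro sum.mono_neutral_right finite_exponent_splittings sub ballI)
      fix x assume "x \<in> {(\<alpha>, \<beta>). \<alpha> + \<beta> = \<kappa>} - ?A"
      then have "fst x + snd x = \<kappa>" "(fst x, snd x) \<notin> ?A"
        using DiffD1 DiffD2 by fastforce+
      then show "(case x of (\<alpha>, \<beta>) \<Rightarrow> mono_coeff c (\<alpha>, k) * mono_coeff (s k) (\<beta>, i)) = 0"
        unfolding case_prod_unfold by (rule zero)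
    qed
    also have "\<dots> = (if snd (lm lt (s k)) = i \<and> ?b \<le> \<kappa>
       then mono_coeff c (\<kappa> - ?b, k) * lc lt (s k) else 0)"
      by (auto simp: lc_def)
    finally show ?thesis .
  qed
  then show ?thesis
    using carrier assms(1) by (subst mono_coeff_combination) (auto intro!: sum.cong)
qed

section \<open>The Schreyer order and syzygies\<close>

lemma schreyer_order_iff:
  "schreyer_order lt q s (\<mu>, j) (\<mu>', k) \<longleftrightarrow>
    j < q \<and> k < q \<and> (lt (lead \<mu> j) (lead \<mu>' k) \<or> lead \<mu> j = lead \<mu>' k \<and> j < k)"
  using lm_monom_smult(1)[OF carrier nonzero] by (auto simp: schreyer_order_def mon_def)

text \<open>The order is lexicographic in the pair of lead and index, and this pair determines the
  monomial by cancellation. The compatible order on exponents is the one belonging to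
  \<open>lt\<close>.\<close>

lemma monomial_order_schreyer_order: "monomial_order q (schreyer_order lt q s)"
proof -
  obtain lt0 where lt0: "exponent_order lt0"
    "\<And>\<mu> \<nu> i. i < p \<Longrightarrow> lt0 \<mu> \<nu> \<Longrightarrow> lt (\<mu>, i) (\<nu>, i)"
    using monomial_order by (auto simp: monomial_order_def)
  show ?thesis
    unfolding monomial_order_def
  proof (intro conjI exI[of _ lt0] allI impI)
    show "irreflp_on (mon q) (schreyer_order lt q s)"
      by (rule irreflp_onI) (auto simp: mon_def schreyer_order_iff dest: lt_irrefl[OF lead_in_mon])
    show "transp_on (mon q) (schreyer_order lt q s)"
    proof (rule transp_onI)
      fix a b c :: "'d mono"
      assume "a \<in> mon q" "b \<in> mon q" "c \<in> mon q"
        and ab: "schreyer_order lt q s a b" and bc: "schreyer_order lt q s b c"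
      obtain \<mu>1 j1 \<mu>2 j2 \<mu>3 j3 where [simp]: "a = (\<mu>1, j1)" "b = (\<mu>2, j2)" "c = (\<mu>3, j3)"
        by (cases a, cases b, cases c)
      have j: "j1 < q" "j2 < q" "j3 < q"
        using ab bc by (auto simp: schreyer_order_iff)
      have lex: "lt A C \<or> A = C \<and> j1 < j3"
        if "lt A B \<or> A = B \<and> j1 < j2" "lt B C \<or> B = C \<and> j2 < j3"
          "A \<in> mon p" "B \<in> mon p" "C \<in> mon p" for A B C
        using that lt_trans[of A B C] by auto
      have "lt (lead \<mu>1 j1) (lead \<mu>3 j3) \<or> lead \<mu>1 j1 = lead \<mu>3 j3 \<and> j1 < j3"
      proof (rule lex)
        show "lt (lead \<mu>1 j1) (lead \<mu>2 j2) \<or> lead \<mu>1 j1 = lead \<mu>2 j2 \<and> j1 < j2"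
          "lt (lead \<mu>2 j2) (lead \<mu>3 j3) \<or> lead \<mu>2 j2 = lead \<mu>3 j3 \<and> j2 < j3"
          using ab bc by (simp_all only: \<open>a = _\<close> \<open>b = _\<close> \<open>c = _\<close> schreyer_order_iff)
      qed (use j lead_in_mon in auto)
      with j show "schreyer_order lt q s a c" by (simp add: schreyer_order_iff)
    qed
    show "totalp_on (mon q) (schreyer_order lt q s)"
    proof (rule totalp_onI)
      fix a b :: "'d mono"
      assume "a \<in> mon q" "b \<in> mon q" "a \<noteq> b"
      then obtain \<mu> j \<mu>' k where [simp]: "a = (\<mu>, j)" "b = (\<mu>', k)" and jk: "j < q" "k < q"
        by (auto simp: mon_def)
      have "lead \<mu> j \<noteq> lead \<mu>' k \<or> j \<noteq> k"
        using \<open>a \<noteq> b\<close> by auto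
      then show "schreyer_order lt q s a b \<or> schreyer_order lt q s b a"
      proof
        assume "lead \<mu> j \<noteq> lead \<mu>' k"
        then have "lt (lead \<mu> j) (lead \<mu>' k) \<or> lt (lead \<mu>' k) (lead \<mu> j)"
          by (rule lt_total) (use jk lead_in_mon in auto)
        then show ?thesis using jk by (auto simp: schreyer_order_iff)
      next
        assume "j \<noteq> k"
        then show ?thesis
          using lt_total[of "lead \<mu> j" "lead \<mu>' k"] lead_in_mon[of j \<mu>] lead_in_mon[of k \<mu>'] jk
          by (cases "lead \<mu> j = lead \<mu>' k") (auto simp: schreyer_order_iff)
      qed
    qed
    show "exponent_order lt0" by fact
    fix \<mu> \<nu> i assume "i < q" "lt0 \<mu> \<nu>"
    then have "lt0 (\<mu> + fst (lm lt (s i))) (\<nu> + fst (lm lt (s i)))"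
      using lt0(1) by (simp add: exponent_order_def)
    with \<open>i < q\<close> show "schreyer_order lt q s (\<mu>, i) (\<nu>, i)"
      using lt0(2) snd_lm_less[OF carrier nonzero] by (simp add: schreyer_order_iff)
  next
    fix \<mu> \<mu>' \<nu> i j assume "i < q" "j < q" "schreyer_order lt q s (\<mu>, i) (\<mu>', j)"
    moreover have "\<alpha> + \<nu> + \<beta> = \<alpha> + \<beta> + \<nu>" for \<alpha> \<beta> :: "'d \<Rightarrow> nat"
      by (simp add: ac_simps)
    ultimately show "schreyer_order lt q s (\<mu> + \<nu>, i) (\<mu>' + \<nu>, j)"
      using lead_shift[of \<mu> i \<mu>' j \<nu>] by (auto simp: schreyer_order_iff)
  qed
qed

text \<open>
  The coefficient of \<open>\<Sum> c\<^sub>k s\<^sub>k = 0\<close> at the leading monomial of \<open>x\<^sup>\<mu> s\<^sub>j\<close> only involves the leading terms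
  of the \<open>s\<^sub>k\<close>, and the contribution of \<open>s\<^sub>j\<close> must cancel against another one.
\<close>

lemma syzygy_lm_cancels:
  assumes c: "c \<in> carrier_vec q" and zero: "combination p q s c = 0\<^sub>v p"
    and in_supp: "(\<mu>, j) \<in> supp c"
    and least: "\<And>m. m \<in> supp c \<Longrightarrow> m \<noteq> (\<mu>, j) \<Longrightarrow> schreyer_order lt q s (\<mu>, j) m"
  obtains k where "j < k" "k < q" "snd (lm lt (s k)) = snd (lm lt (s j))"
    "fst (lm lt (s k)) \<le> \<mu> + fst (lm lt (s j))"
proof -
  interpret Q: ordered_monomials q "schreyer_order lt q s"
    by unfold_locales (rule monomial_order_schreyer_order)
  have j: "j < q" using Q.supp_subset[OF c] in_supp by (auto simp: mon_def)
  \<comment> \<open>\<open>(\<kappa>, i)\<close> is the leading monomial of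
    \<open>x^\<mu> s j\<close>; the vanishing combination is evaluated there.\<close>
  define \<kappa> i where "\<kappa> = \<mu> + fst (lm lt (s j))" and "i = snd (lm lt (s j))"
  have i: "i < p" using snd_lm_less[OF carrier[OF j] nonzero[OF j]] by (simp add: i_def)
  let ?t = "\<lambda>k. if snd (lm lt (s k)) = i \<and> fst (lm lt (s k)) \<le> \<kappa>
       then mono_coeff c (\<kappa> - fst (lm lt (s k)), k) * lc lt (s k) else 0"
  \<comment> \<open>Minimality of \<open>(\<mu>, j)\<close> in the Schreyer order excludes smaller
    leads in \<open>c\<close>, but not equal ones.\<close>
  have not_less: "\<not> lt (lead \<nu> k) (\<kappa>, i)" if k: "k < q" "mono_coeff c (\<nu>, k) \<noteq> 0" for \<nu> k
  proof (cases "(\<nu>, k) = (\<mu>, j)")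
    case True
    then show ?thesis using lt_irrefl[OF lead_in_mon[OF j]] by (simp add: \<kappa>_def i_def)
  next
    case False
    moreover have "(\<nu>, k) \<in> supp c" using k c by (simp add: supp_def mon_def)
    ultimately have "lt (\<kappa>, i) (lead \<nu> k) \<or> (\<kappa>, i) = lead \<nu> k"
      using least[of "(\<nu>, k)"] by (auto simp: schreyer_order_iff \<kappa>_def i_def)
    moreover have "(\<kappa>, i) \<in> mon p" using i by (simp add: mon_def)
    ultimately show ?thesis
      using lt_irrefl lt_trans lead_in_mon[OF k(1)] by metis
  qed
  have "0 = mono_coeff (combination p q s c) (\<kappa>, i)"
    using i by (simp add: zero mono_coeff_def zero_mps.rep_eq)
  also have "\<dots> = (\<Sum>k<q. ?t k)"
    by (rule mono_coeff_combination_lead[OF i not_less])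
  also have "\<dots> = ?t j + (\<Sum>k\<in>{..<q} - {j}. ?t k)"
    using j by (subst sum.remove[of _ j]) auto
  finally have sum: "?t j + (\<Sum>k\<in>{..<q} - {j}. ?t k) = 0" by simp
  \<comment> \<open>The summand of \<open>j\<close> is the coefficient of \<open>c\<close> at
    \<open>(\<mu>, j)\<close> times \<open>lc lt (s j)\<close>, both nonzero; as the sum vanishes,
    another summand is nonzero.\<close>
  have "fst (lm lt (s j)) \<le> \<kappa>" "\<kappa> - fst (lm lt (s j)) = \<mu>"
    by (auto simp: \<kappa>_def le_fun_def)
  then have "?t j \<noteq> 0"
    using in_supp lc_nonzero[OF carrier[OF j] nonzero[OF j]] by (simp add: i_def supp_def)
  with sum have "(\<Sum>k\<in>{..<q} - {j}. ?t k) \<noteq> 0" by auto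
  then obtain k where "k \<in> {..<q} - {j}" and tk: "?t k \<noteq> 0"
    by (rule sum.not_neutral_contains_not_neutral)
  then have k: "k < q" "k \<noteq> j" by auto
  then have cond: "snd (lm lt (s k)) = i" "fst (lm lt (s k)) \<le> \<kappa>"
    "mono_coeff c (\<kappa> - fst (lm lt (s k)), k) \<noteq> 0"
    using tk by (auto split: if_splits)
  have "\<kappa> - fst (lm lt (s k)) + fst (lm lt (s k)) = \<kappa>"
    using cond(2) by (auto simp: le_fun_def)
  moreover have "(\<kappa> - fst (lm lt (s k)), k) \<in> supp c"
    using cond(3) k(1) c by (simp add: supp_def mon_def)
  then have "schreyer_order lt q s (\<mu>, j) (\<kappa> - fst (lm lt (s k)), k)"
    using least k(2) by simp
  \<comment> \<open>Both leads are equal to \<open>(\<kappa>, i)\<close>, so only the tie-break by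
    index can have put \<open>(\<mu>, j)\<close> first.\<close>
  ultimately have "j < k"
    using lt_irrefl[OF lead_in_mon[OF j]] cond(1) by (auto simp: schreyer_order_iff \<kappa>_def i_def)
  then show thesis
    using that[of k] k(1) cond(1,2) by (simp add: \<kappa>_def i_def)
qed

text \<open>The inequality \<open>j < k\<close> from \<open>syzygy_lm_cancels\<close> matches the
  family, which has one syzygy for each overlapping pair \<open>j < k\<close>, with leading monomial
  at position \<open>j\<close>.\<close>

theorem schreyer_family_standard_basis:
  assumes sub: "submodule class_ring (syz p q s) (free_mod q)"
    and F: "schreyer_family lt p q s F"
  shows "standard_basis q (schreyer_order lt q s) (syz p q s) F"
proof -
  interpret Q: ordered_monomials q "schreyer_order lt q s"
    by unfold_locales (rule monomial_order_schreyer_order)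
  obtain \<sigma> where \<sigma>: "\<And>j k. j < k \<Longrightarrow> k < q \<Longrightarrow> overlapping lt s j k \<Longrightarrow> schreyer_syzygy lt p q s j k (\<sigma> j k)"
    and F_eq: "F = {\<sigma> j j' | j j'. j < j' \<and> j' < q \<and> overlapping lt s j j'}"
    using F unfolding schreyer_family_def by blast
  have FL: "F \<subseteq> syz p q s"
    using \<sigma> by (auto simp: F_eq schreyer_syzygy_def Let_def)
  have "lm_set (schreyer_order lt q s) (syz p q s) \<subseteq> mono_multiples (lm_set (schreyer_order lt q s) F)"
  proof
    fix m assume "m \<in> lm_set (schreyer_order lt q s) (syz p q s)"
    then obtain c where c: "c \<in> syz p q s" "c \<noteq> 0\<^sub>v (dim_vec c)" "m = lm (schreyer_order lt q s) c"
      by (auto simp: lm_set_def)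
    then have cq: "c \<in> carrier_vec q" "c \<noteq> 0\<^sub>v q" "combination p q s c = 0\<^sub>v p"
      by (auto simp: syz_def)
    obtain \<mu> j where m: "m = (\<mu>, j)" by (cases m)
    obtain k where k: "j < k" "k < q" "snd (lm lt (s k)) = snd (lm lt (s j))"
      "fst (lm lt (s k)) \<le> \<mu> + fst (lm lt (s j))"
      using syzygy_lm_cancels[OF cq(1,3), of \<mu> j] Q.lm_least[OF cq(1,2)] c(3) m by metis
    let ?\<kappa> = "exponent_lcm (fst (lm lt (s j))) (fst (lm lt (s k)))"
    have over: "overlapping lt s j k" using k by (simp add: overlapping_def)
    then have syz: "\<sigma> j k \<noteq> 0\<^sub>v q" "\<sigma> j k \<in> syz p q s"
      "lm (schreyer_order lt q s) (\<sigma> j k) = (?\<kappa> - fst (lm lt (s j)), j)"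
      using \<sigma>[OF k(1,2)] by (auto simp: schreyer_syzygy_def Let_def)
    have "\<sigma> j k \<in> F" using over k by (auto simp: F_eq)
    then have "(?\<kappa> - fst (lm lt (s j)), j) \<in> lm_set (schreyer_order lt q s) F"
      unfolding lm_set_def using syz by (intro image_eqI[of _ _ "\<sigma> j k"]) (auto simp: syz_def)
    \<comment> \<open>Both leading exponents are at most \<open>\<mu> + fst (lm lt (s j))\<close>,
      hence so is \<open>?\<kappa>\<close>, and the truncated subtractions are exact.\<close>
    moreover have "\<mu> = (\<mu> + fst (lm lt (s j)) - ?\<kappa>) + (?\<kappa> - fst (lm lt (s j)))"
    proof
      fix x
      have "fst (lm lt (s k)) x \<le> \<mu> x + fst (lm lt (s j)) x"
        using k(4) by (auto simp: le_fun_def)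
      then show "\<mu> x = ((\<mu> + fst (lm lt (s j)) - ?\<kappa>) + (?\<kappa> - fst (lm lt (s j)))) x"
        by (simp add: exponent_lcm_def)
    qed
    ultimately show "m \<in> mono_multiples (lm_set (schreyer_order lt q s) F)"
      unfolding mono_multiples_def m by blast
  qed
  with Q.mono_multiples_lm_set_subset[OF sub FL] sub FL show ?thesis
    by (auto simp: standard_basis_def)
qed

end

text \<open>
  The coefficients of \<open>c\<close> are determined by recursion along the well-order on monomials: the coefficient
  of \<open>\<Sum> c\<^sub>j s\<^sub>j\<close> at a monomial \<open>m \<in> lm(L)\<close> is a nonzero multiple of one coefficient of \<open>c\<close>, namely the one
  of a chosen \<open>x\<^sup>\<nu> e\<^sub>j\<close> with \<open>lm(x\<^sup>\<nu> s\<^sub>j) = m\<close>, plus terms given by the coefficients chosen for smaller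
  monomials.  Each coefficient of a product is a finite sum, so no convergence is involved.
\<close>

theorem (in ordered_family) standard_basis_generates:
  assumes sb: "standard_basis p lt L (s ` {..<q})" and f: "f \<in> L"
  obtains c where "c \<in> carrier_vec q" "f = combination p q s c"
proof -
  have sub: "submodule class_ring L (free_mod p)"
    and sL: "\<forall>j<q. s j \<in> L"
    and lm_L: "lm_set lt L = mono_multiples (lm_set lt (s ` {..<q}))"
    using sb by (auto simp: standard_basis_def)
  have L: "L \<subseteq> carrier_vec p" "\<And>v w. v \<in> L \<Longrightarrow> w \<in> L \<Longrightarrow> v + w \<in> L"
    "\<And>c v. v \<in> L \<Longrightarrow> c \<cdot>\<^sub>v v \<in> L"
    using sub by (auto simp: LinearCombinations.submodule_def module_vec_simps)
  \<comment> \<open>It suffices to match \<open>f\<close> on \<open>T\<close>, since a nonzero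
    remainder in \<open>L\<close> has its leading monomial there.\<close>
  define T where "T = lm_set lt L"
  have T_lead: "\<exists>j \<nu>. j < q \<and> m = lead \<nu> j" if mT: "m \<in> T" for m
  proof -
    obtain \<mu> \<nu> i where m: "m = (\<mu> + \<nu>, i)" "(\<nu>, i) \<in> lm_set lt (s ` {..<q})"
      using mT unfolding T_def lm_L mono_multiples_def by blast
    then obtain j where "j < q" "(\<nu>, i) = lm lt (s j)"
      unfolding lm_set_def by blast
    then have "m = lead \<mu> j" using m(1) by (metis fst_conv snd_conv)
    with \<open>j < q\<close> show ?thesis by blast
  qed
  \<comment> \<open>Several \<open>lead \<nu> j\<close> may be the same monomial; \<open>h\<close>
    chooses one index for each.\<close>
  then obtain h where h: "\<And>m. m \<in> T \<Longrightarrow> h m < q \<and> (\<exists>\<nu>. m = lead \<nu> (h m))"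
    by metis
  have T_mon: "m \<in> mon p" if "m \<in> T" for m
    using T_lead[OF that] lead_in_mon by auto
  \<comment> \<open>The scalar \<open>a m\<close> is placed on the one term
    \<open>x^\<nu> e_k\<close> with \<open>k = h m\<close> and \<open>lead \<nu> k = m\<close>; all
    other terms get zero.\<close>
  define C :: "('d mono \<Rightarrow> 'k) \<Rightarrow> ('d, 'k) mps vec" where
    "C a = vec q (\<lambda>k. Abs_mps (\<lambda>\<nu>. if lead \<nu> k \<in> T \<and> h (lead \<nu> k) = k then a (lead \<nu> k) else 0))" for a
  have C_carrier: "C a \<in> carrier_vec q" for a by (simp add: C_def)
  have C_coeff: "mono_coeff (C a) (\<nu>, k) = (if lead \<nu> k \<in> T \<and> h (lead \<nu> k) = k then a (lead \<nu> k) else 0)"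
    if "k < q" for a \<nu> k
    using that by (simp add: C_def mono_coeff_def Abs_mps_inverse)
  define E where "E a = combination p q s (C a)" for a
  have E_carrier: "E a \<in> carrier_vec p" for a
    unfolding E_def using carrier by (intro combination_carrier) auto
  have E_diff: "mono_coeff (E (\<lambda>m. a m - b m)) m = mono_coeff (E a) m - mono_coeff (E b) m"
    if mp: "m \<in> mon p" for a b m
  proof -
    obtain \<kappa> i where m: "m = (\<kappa>, i)" "i < p"
      using mp by (auto simp: mon_def)
    show ?thesis
      unfolding E_def m(1) using carrier m(2)
      by (subst (1 2 3) mono_coeff_combination)
        (auto simp: C_coeff case_prod_unfold simp flip: sum_subtractf intro!: sum.cong simp: algebra_simps)
  qed
  \<comment> \<open>Triangularity: only terms with lead \<open>m\<close> can contribute at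
    \<open>m\<close>, and among them only the chosen one has a coefficient.\<close>
  have E_lead: "mono_coeff (E d) m = d m * lc lt (s (h m))"
    if m: "m \<in> T" and d: "\<And>y. y \<in> T \<Longrightarrow> lt y m \<Longrightarrow> d y = 0" for d m
  proof -
    obtain \<kappa> i where mi: "m = (\<kappa>, i)" by (cases m)
    then have i: "i < p" using T_mon[OF m] by (simp add: mon_def)
    have "mono_coeff (E d) m = (\<Sum>k<q. if snd (lm lt (s k)) = i \<and> fst (lm lt (s k)) \<le> \<kappa>
       then mono_coeff (C d) (\<kappa> - fst (lm lt (s k)), k) * lc lt (s k) else 0)"
      unfolding E_def mi using d by (intro mono_coeff_combination_lead i) (auto simp: C_coeff mi split: if_splits)
    also have "\<dots> = (\<Sum>k<q. if k = h m then d m * lc lt (s k) else 0)"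
    proof (intro sum.cong refl)
      fix k assume "k \<in> {..<q}"
      then have k: "k < q" by simp
      show "(if snd (lm lt (s k)) = i \<and> fst (lm lt (s k)) \<le> \<kappa>
          then mono_coeff (C d) (\<kappa> - fst (lm lt (s k)), k) * lc lt (s k) else 0)
        = (if k = h m then d m * lc lt (s k) else 0)"
      proof (cases "snd (lm lt (s k)) = i \<and> fst (lm lt (s k)) \<le> \<kappa>")
        case True
        then have "lead (\<kappa> - fst (lm lt (s k))) k = m"
          by (auto simp: mi le_fun_def)
        with True k m show ?thesis by (auto simp: C_coeff)
      next
        case False
        have "k \<noteq> h m"
        proof
          assume "k = h m"
          then obtain \<nu> where "\<kappa> = \<nu> + fst (lm lt (s k))" "i = snd (lm lt (s k))"
            using h[OF m] mi by blast
          with False show False by (simp add: le_fun_def)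
        qed
        with False show ?thesis by auto
      qed
    qed
    also have "\<dots> = d m * lc lt (s (h m))"
      using h[OF m] by simp
    finally show ?thesis .
  qed
  \<comment> \<open>Replaces \<open>a\<close> by its part below \<open>m\<close>, with a trial value
    \<open>r\<close> at \<open>m\<close>. The equation at \<open>m\<close> then depends on
    \<open>a\<close> through smaller monomials only, as \<open>dependent_wf_choice\<close>
    requires.\<close>
  define below where "below a m r = (\<lambda>y. if y = m then r else if y \<in> mon p \<and> m \<in> mon p \<and> lt y m then a y else 0)"
    for a :: "'d mono \<Rightarrow> 'k" and m r
  have "\<exists>a. \<forall>m. m \<in> T \<longrightarrow> mono_coeff (E (below a m (a m))) m = mono_coeff f m"
  proof (rule dependent_wf_choice[OF wf_lt])
    fix a b :: "'d mono \<Rightarrow> 'k" and m r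
    assume "\<And>y. (y, m) \<in> {(m, m'). m \<in> mon p \<and> m' \<in> mon p \<and> lt m m'} \<Longrightarrow> a y = b y"
    then have "below a m r = below b m r" by (auto simp: below_def)
    then show "(m \<in> T \<longrightarrow> mono_coeff (E (below a m r)) m = mono_coeff f m) =
        (m \<in> T \<longrightarrow> mono_coeff (E (below b m r)) m = mono_coeff f m)" by simp
  next
    fix m and a :: "'d mono \<Rightarrow> 'k"
    show "\<exists>r. m \<in> T \<longrightarrow> mono_coeff (E (below a m r)) m = mono_coeff f m"
    proof (cases "m \<in> T")
      case True
      \<comment> \<open>The equation at \<open>m\<close> is affine in the trial value with nonzero
        slope \<open>lc lt (s (h m))\<close>; this is its solution.\<close>
      define r where "r = (mono_coeff f m - mono_coeff (E (below a m 0)) m) / lc lt (s (h m))"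
      have "mono_coeff (E (\<lambda>y. below a m r y - below a m 0 y)) m = r * lc lt (s (h m))"
        using lt_irrefl[OF T_mon[OF True]] by (subst E_lead[OF True]) (auto simp: below_def)
      moreover have "lc lt (s (h m)) \<noteq> 0"
        using lc_nonzero carrier nonzero h[OF True] by blast
      ultimately have "mono_coeff (E (below a m r)) m = mono_coeff f m"
        by (simp add: E_diff[OF T_mon[OF True]] r_def)
      then show ?thesis by blast
    qed simp
  qed
  then obtain a where a: "\<And>m. m \<in> T \<Longrightarrow> mono_coeff (E (below a m (a m))) m = mono_coeff f m"
    by blast
  have agree: "mono_coeff (E a) m = mono_coeff f m" if m: "m \<in> T" for m
  proof -
    \<comment> \<open>On \<open>T\<close>, the function \<open>a\<close> and its truncation agree at
      \<open>m\<close> and below, so by triangularity the values above \<open>m\<close> do not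
      matter.\<close>
    have "mono_coeff (E (\<lambda>y. a y - below a m (a m) y)) m = 0"
      using T_mon m by (subst E_lead[OF m]) (auto simp: below_def)
    then show ?thesis by (simp add: E_diff[OF T_mon[OF m]] a[OF m])
  qed
  have fp: "f \<in> carrier_vec p" using f L(1) by blast
  define g where "g = f + (-1) \<cdot>\<^sub>v E a"
  have gL: "g \<in> L"
    unfolding g_def E_def by (intro L(2,3) f combination_in_submodule sub sL)
  then have gp: "g \<in> carrier_vec p" using L(1) by blast
  \<comment> \<open>The remainder lies in \<open>L\<close>; were it nonzero, its leading monomial
    would lie in \<open>T\<close>, where its coefficient has been made zero.\<close>
  have "g = 0\<^sub>v p"
  proof (rule ccontr)
    assume g0: "g \<noteq> 0\<^sub>v p"
    then have "lm lt g \<in> T"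
      using gL gp by (auto simp: T_def lm_set_def)
    moreover have "mono_coeff g (lm lt g) \<noteq> 0"
      using lm_least(1)[OF gp g0] by (simp add: supp_def)
    moreover have "mono_coeff g m = mono_coeff f m - mono_coeff (E a) m" if "m \<in> mon p" for m
      using that fp E_carrier[of a] by (auto simp: g_def mono_coeff_def mon_def mps_nth_simps)
    ultimately show False
      using agree T_mon by simp
  qed
  then have "f = E a"
    using fp E_carrier[of a] by (auto simp: g_def vec_eq_iff)
  then show thesis
    using that C_carrier by (auto simp: E_def)
qed

section \<open>Quotients and freeness\<close>

text \<open>Closure under negation comes from the scalar \<open>-1\<close>.\<close>

lemma submodule_abelian_subgroup:
  assumes "submodule R N M"
  shows "abelian_subgroup N M"
proof -
  interpret Module.module R M using assms by (simp add: LinearCombinations.submodule_def)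
  have N: "N \<subseteq> carrier M" "\<zero>\<^bsub>M\<^esub> \<in> N" "\<And>v w. v \<in> N \<Longrightarrow> w \<in> N \<Longrightarrow> v \<oplus>\<^bsub>M\<^esub> w \<in> N"
    "\<And>c v. c \<in> carrier R \<Longrightarrow> v \<in> N \<Longrightarrow> c \<odot>\<^bsub>M\<^esub> v \<in> N"
    using assms by (auto simp: LinearCombinations.submodule_def)
  have neg: "\<ominus>\<^bsub>M\<^esub> v \<in> N" if "v \<in> N" for v
  proof -
    have "(\<ominus>\<^bsub>R\<^esub> \<one>\<^bsub>R\<^esub>) \<odot>\<^bsub>M\<^esub> v \<in> N" using N(4) that by simp
    moreover have "(\<ominus>\<^bsub>R\<^esub> \<one>\<^bsub>R\<^esub>) \<odot>\<^bsub>M\<^esub> v = \<ominus>\<^bsub>M\<^esub> v"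
      using N(1) that by (subst smult_l_minus) auto
    ultimately show ?thesis by (simp only:)
  qed
  have "subgroup N (add_monoid M)"
    using N neg by (intro M.add.subgroupI) (auto simp flip: a_inv_def)
  then show ?thesis
    using M.a_comm_group by (intro abelian_subgroupI2)
qed

text \<open>The union in \<open>quotient_module\<close> runs over all representatives. Their
  multiples by \<open>a\<close> differ by elements of \<open>N\<close>, so all yield one coset and
  the union collapses.\<close>

lemma quotient_smult:
  assumes "submodule R N M" "a \<in> carrier R" "x \<in> carrier M"
  shows "a \<odot>\<^bsub>quotient_module M N\<^esub> (N +>\<^bsub>M\<^esub> x) = N +>\<^bsub>M\<^esub> (a \<odot>\<^bsub>M\<^esub> x)"
proof -
  interpret Module.module R M using assms by (simp add: LinearCombinations.submodule_def)
  interpret abelian_subgroup N M by (rule submodule_abelian_subgroup) fact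
  have N: "N \<subseteq> carrier M" "\<And>c v. c \<in> carrier R \<Longrightarrow> v \<in> N \<Longrightarrow> c \<odot>\<^bsub>M\<^esub> v \<in> N"
    using assms by (auto simp: LinearCombinations.submodule_def)
  have "N +>\<^bsub>M\<^esub> (a \<odot>\<^bsub>M\<^esub> y) = N +>\<^bsub>M\<^esub> (a \<odot>\<^bsub>M\<^esub> x)" if y: "y \<in> N +>\<^bsub>M\<^esub> x" for y
  proof -
    obtain n where n: "n \<in> N" "y = n \<oplus>\<^bsub>M\<^esub> x"
      using y by (auto simp: a_r_coset_def')
    then have "a \<odot>\<^bsub>M\<^esub> y = (a \<odot>\<^bsub>M\<^esub> n) \<oplus>\<^bsub>M\<^esub> (a \<odot>\<^bsub>M\<^esub> x)"
      using N assms by (auto simp: smult_r_distr)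
    then have "a \<odot>\<^bsub>M\<^esub> y \<in> N +>\<^bsub>M\<^esub> (a \<odot>\<^bsub>M\<^esub> x)"
      using N(2) n(1) assms(2) by (auto simp: a_r_coset_def')
    then show ?thesis
      using M.a_repr_independence[OF _ _ a_subgroup, symmetric] assms by simp
  qed
  moreover have "x \<in> N +>\<^bsub>M\<^esub> x" using a_rcos_self assms(3) by blast
  ultimately have "(\<Union>y\<in>N +>\<^bsub>M\<^esub> x. N +>\<^bsub>M\<^esub> (a \<odot>\<^bsub>M\<^esub> y)) = N +>\<^bsub>M\<^esub> (a \<odot>\<^bsub>M\<^esub> x)"
    by (intro UN_constant_eq) blast+
  then show ?thesis by (simp add: quotient_module_def)
qed

lemma carrier_quotient_module: "carrier (quotient_module M N) = (\<lambda>v. N +>\<^bsub>M\<^esub> v) ` carrier M"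
  unfolding quotient_module_def A_RCOSETS_def RCOSETS_def a_r_coset_def by auto

text \<open>The module axioms are transported from \<open>M\<close> along the projection, which is
  onto and respects both operations.\<close>

lemma mod_hom_quotient:
  assumes sub: "submodule R N M"
  shows "mod_hom R M (quotient_module M N) (\<lambda>v. N +>\<^bsub>M\<^esub> v)"
proof -
  let ?Q = "quotient_module M N" and ?\<pi> = "\<lambda>v. N +>\<^bsub>M\<^esub> v"
  interpret Module.module R M using assms by (simp add: LinearCombinations.submodule_def)
  interpret abelian_subgroup N M by (rule submodule_abelian_subgroup) fact
  note carrier = carrier_quotient_module[of M N]
  have add: "?\<pi> x \<oplus>\<^bsub>?Q\<^esub> ?\<pi> y = ?\<pi> (x \<oplus>\<^bsub>M\<^esub> y)" if "x \<in> carrier M" "y \<in> carrier M" for x y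
    using a_rcos_sum that by (simp add: quotient_module_def)
  note smult = quotient_smult[OF sub]
  have zero: "\<zero>\<^bsub>?Q\<^esub> = ?\<pi> \<zero>\<^bsub>M\<^esub>"
    using a_subset by (simp add: quotient_module_def)
  have "abelian_group ?Q"
  proof (rule abelian_groupI)
    fix X assume "X \<in> carrier ?Q"
    then obtain x where x: "x \<in> carrier M" "X = ?\<pi> x" by (auto simp: carrier)
    then show "\<exists>Y\<in>carrier ?Q. Y \<oplus>\<^bsub>?Q\<^esub> X = \<zero>\<^bsub>?Q\<^esub>"
      by (intro bexI[of _ "?\<pi> (\<ominus>\<^bsub>M\<^esub> x)"]) (auto simp: carrier add zero M.l_neg)
  qed (auto simp: carrier add zero M.a_ac)
  then have Q: "module R ?Q"
    by (intro moduleI R.cring_axioms)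
      (auto simp: carrier add smult smult_l_distr smult_r_distr smult_assoc1)
  show ?thesis
    by (intro mod_hom.intro module_axioms Q mod_hom_axioms.intro)
      (auto simp: LinearCombinations.module_hom_def carrier add smult)
qed

lemma ker_im_quotient:
  assumes "submodule R N M"
  shows "mod_hom.ker M (quotient_module M N) (\<lambda>v. N +>\<^bsub>M\<^esub> v) = N"
    and "mod_hom.im M (\<lambda>v. N +>\<^bsub>M\<^esub> v) = carrier (quotient_module M N)"
proof -
  interpret Module.module R M using assms by (simp add: LinearCombinations.submodule_def)
  interpret abelian_subgroup N M by (rule submodule_abelian_subgroup) fact
  note hom = mod_hom_quotient[OF assms]
  have "\<zero>\<^bsub>quotient_module M N\<^esub> = N" by (simp add: quotient_module_def)
  note ker = mod_hom.ker_def[OF hom, unfolded this]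
  show "mod_hom.ker M (quotient_module M N) (\<lambda>v. N +>\<^bsub>M\<^esub> v) = N"
  proof (intro equalityI subsetI)
    fix v assume "v \<in> mod_hom.ker M (quotient_module M N) (\<lambda>v. N +>\<^bsub>M\<^esub> v)"
    then have "v \<in> carrier M" "N +>\<^bsub>M\<^esub> v = N" by (simp_all only: ker mem_Collect_eq)
    then show "v \<in> N" using M.a_coset_join1 a_subgroup by blast
  next
    fix v assume v: "v \<in> N"
    then have "v \<in> carrier M" using a_subset by blast
    moreover from this have "N +>\<^bsub>M\<^esub> v = N" using M.a_coset_join2 a_subgroup v by blast
    ultimately show "v \<in> mod_hom.ker M (quotient_module M N) (\<lambda>v. N +>\<^bsub>M\<^esub> v)"
      by (simp only: ker mem_Collect_eq)
  qed
  show "mod_hom.im M (\<lambda>v. N +>\<^bsub>M\<^esub> v) = carrier (quotient_module M N)"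
    by (simp only: mod_hom.im_def[OF hom] carrier_quotient_module)
qed

text \<open>The unit vectors form a basis: in a vanishing linear combination, coordinate
  \<open>i\<close> reads off the coefficient of \<open>unit_vec r i\<close>.\<close>

lemma free_module_free_mod: "free_module class_ring (free_mod r :: (('d :: finite, 'k :: field) mps, _) module)"
proof -
  interpret vec_module "TYPE(('d, 'k) mps)" r .
  let ?B = "unit_vec r ` {..<r} :: ('d, 'k) mps vec set"
  have B: "?B \<subseteq> carrier_vec r" by auto
  have "\<not> lin_dep ?B"
  proof
    assume "lin_dep ?B"
    then obtain A a v where A: "finite A" "A \<subseteq> ?B" "lincomb a A = 0\<^sub>v r" "v \<in> A" "a v \<noteq> 0"
      by (auto simp: lin_dep_def module_vec_simps)
    then obtain i where i: "i < r" "v = unit_vec r i" by auto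
    have Ac: "A \<subseteq> carrier_vec r" using A(2) by auto
    have "0 = lincomb a A $ i" using A(3) i by simp
    also have "\<dots> = (\<Sum>x\<in>A. (a x \<cdot>\<^sub>v x) $ i)"
      unfolding lincomb_def using Ac i A(1) by (subst finsum_free_mod(2)) (auto simp: module_vec_simps)
    also have "\<dots> = (\<Sum>x\<in>A. if x = v then a v else 0)"
      using A(2) i by (intro sum.cong) auto
    also have "\<dots> = a v" using A(1,4) by simp
    finally show False using A(5) by simp
  qed
  moreover have "span ?B = carrier V"
  proof
    show "span ?B \<subseteq> carrier V"
      using span_is_subset2[OF B] by (simp add: module_vec_simps)
    show "carrier V \<subseteq> span ?B"
    proof
      fix v assume "v \<in> carrier V"
      then have "v = combination r r (unit_vec r) v"
        by (intro unit_vec_combination) (simp add: module_vec_simps)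
      moreover have "combination r r (unit_vec r) v \<in> span ?B"
        using in_own_span[OF B] by (intro combination_in_submodule span_is_submodule B) auto
      ultimately show "v \<in> span ?B" by simp
    qed
  qed
  ultimately show ?thesis
    unfolding free_module_def using B module_free_mod by (auto simp: module_vec_simps)
qed

section \<open>The resolution\<close>

text \<open>Supplies the conditions of \<open>ordered_family\<close> on the vectors of the next
  stage.\<close>

lemma schreyer_family_memD:
  assumes "schreyer_family lt p q s F" "\<sigma> \<in> F"
  shows "\<sigma> \<in> carrier_vec q" "\<sigma> \<noteq> 0\<^sub>v q"
  using assms by (auto simp: schreyer_family_def schreyer_syzygy_def syz_def Let_def)

theorem mainTheorem3:
  fixes p q :: nat
    and s :: "nat \<Rightarrow> ('d :: finite, 'k :: field) mps vec"
    and S :: "('d, 'k) mps vec set"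
    and prec :: "'d mono \<Rightarrow> 'd mono \<Rightarrow> bool"
    and rk :: "nat \<Rightarrow> nat"
    and ord :: "nat \<Rightarrow> 'd mono \<Rightarrow> 'd mono \<Rightarrow> bool"
    and SS :: "nat \<Rightarrow> ('d, 'k) mps vec set"
    and \<delta> :: "nat \<Rightarrow> ('d, 'k) mps vec \<Rightarrow> ('d, 'k) mps vec"
    and \<delta>0 :: "('d, 'k) mps vec \<Rightarrow> ('d, 'k) mps vec set"
    and M :: "(('d, 'k) mps, ('d, 'k) mps vec set) module"
  assumes "p \<ge> 1" and "q \<ge> 1"
    and "S = s ` {..<q}"
    and "\<forall>j<q. s j \<in> carrier_vec p \<and> s j \<noteq> 0\<^sub>v p"
    and "M = quotient_module (free_mod p) (LinearCombinations.module.span class_ring (free_mod p) S)"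
    and "monomial_order p prec"
    and "standard_basis p prec (LinearCombinations.module.span class_ring (free_mod p) S) S"
    and "rk 0 = p" and "rk 1 = q" and "ord 0 = prec" and "SS 0 = S"
    and "\<delta>0 = (\<lambda>v. LinearCombinations.module.span class_ring (free_mod p) S +>\<^bsub>free_mod p\<^esub> v)"
    and "mod_hom class_ring (free_mod (rk 1)) (free_mod (rk 0)) (\<delta> 1)"
    and "\<forall>j<q. \<delta> 1 (unit_vec q j) = s j"
    and "\<forall>n\<ge>1. schreyer_family (ord (n - 1)) (rk (n - 1)) (rk n)
                 (\<lambda>j. \<delta> n (unit_vec (rk n) j)) (SS n)"
    and "\<forall>n\<ge>1. ord n = schreyer_order (ord (n - 1)) (rk n) (\<lambda>j. \<delta> n (unit_vec (rk n) j))"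
    and "\<forall>n\<ge>1. rk (n + 1) = card (SS n)"
    and "\<forall>n\<ge>1. mod_hom class_ring (free_mod (rk (n + 1))) (free_mod (rk n)) (\<delta> (n + 1))"
    and "\<forall>n\<ge>1. SS n = (\<lambda>j. \<delta> (n + 1) (unit_vec (rk (n + 1)) j)) ` {..<rk (n + 1)}"
  shows "(\<forall>n\<ge>1.
            standard_basis (rk n) (ord n)
              (mod_hom.ker (free_mod (rk n)) (free_mod (rk (n - 1))) (\<delta> n)) (SS n) \<and>
            exact_upto n (\<lambda>k. free_mod (rk k)) \<delta> \<delta>0 M) \<and>
         free_resolution class_ring (\<lambda>k. free_mod (rk k)) \<delta> \<delta>0 M"
proof -
  let ?F = "\<lambda>n. free_mod (rk n) :: (('d, 'k) mps, ('d, 'k) mps vec) module"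
  let ?N = "LinearCombinations.module.span class_ring (free_mod p) S"
  \<comment> \<open>\<open>b (Suc n)\<close> enumerates \<open>SS n\<close>.\<close>
  define b where "b n = (\<lambda>j. \<delta> n (unit_vec (rk n) j))" for n
  have hom: "mod_hom class_ring (?F (Suc n)) (?F n) (\<delta> (Suc n))" for n
    using assms(13,18) by (cases n) auto
  have schreyer: "schreyer_family (ord n) (rk n) (rk (Suc n)) (b (Suc n)) (SS (Suc n))" for n
    using assms(15)[rule_format, of "Suc n"] by (simp add: b_def)
  have ord_Suc: "ord (Suc n) = schreyer_order (ord n) (rk (Suc n)) (b (Suc n))" for n
    using assms(16)[rule_format, of "Suc n"] by (simp add: b_def)
  have SS_Suc: "SS (Suc n) = b (Suc (Suc n)) ` {..<rk (Suc (Suc n))}" for n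
    using assms(19)[rule_format, of "Suc n"] by (simp add: b_def)
  \<comment> \<open>The invariant of the construction: Schreyer orders are monomial orders and the
    chosen syzygies are nonzero, so each stage starts the next.\<close>
  have fam: "ordered_family (rk n) (ord n) (rk (Suc n)) (b (Suc n))" for n
  proof (induction n)
    case 0
    show ?case
      using assms(4,6,8-10,14) by unfold_locales (auto simp: b_def)
  next
    case (Suc n)
    interpret ordered_family "rk n" "ord n" "rk (Suc n)" "b (Suc n)" by fact
    have "b (Suc (Suc n)) j \<in> SS (Suc n)" if "j < rk (Suc (Suc n))" for j
      using that by (simp add: SS_Suc)
    then show ?case
      using monomial_order_schreyer_order schreyer_family_memD[OF schreyer[of n]]
      by unfold_locales (auto simp: ord_Suc)
  qed
  have sb: "standard_basis (rk (Suc n)) (ord (Suc n)) (mod_hom.ker (?F (Suc n)) (?F n) (\<delta> (Suc n))) (SS (Suc n))"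
    for n
  proof -
    interpret ordered_family "rk n" "ord n" "rk (Suc n)" "b (Suc n)" by (rule fam)
    have ker: "syz (rk n) (rk (Suc n)) (b (Suc n)) = mod_hom.ker (?F (Suc n)) (?F n) (\<delta> (Suc n))"
      unfolding b_def by (rule syz_eq_ker[OF hom])
    show ?thesis
      using schreyer_family_standard_basis[OF _ schreyer] mod_hom.ker_is_submodule[OF hom[of n]]
      by (simp add: ker ord_Suc)
  qed
  \<comment> \<open>The generators \<open>SS (Suc n)\<close> of the image lie in the kernel;
    conversely they are a standard basis of it, and division writes every element of the kernel in
    them.\<close>
  have exact: "mod_hom.im (?F (Suc (Suc n))) (\<delta> (Suc (Suc n))) = mod_hom.ker (?F (Suc n)) (?F n) (\<delta> (Suc n))"
    (is "?im = ?ker") for n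
  proof
    have "SS (Suc n) \<subseteq> ?ker" using sb[of n] by (simp add: standard_basis_def)
    then show "?im \<subseteq> ?ker"
      using LinearCombinations.module.span_is_subset[OF module_free_mod _ mod_hom.ker_is_submodule[OF hom[of n]]]
      by (simp add: im_eq_span[OF hom] SS_Suc b_def)
  next
    interpret ordered_family "rk (Suc n)" "ord (Suc n)" "rk (Suc (Suc n))" "b (Suc (Suc n))" by (rule fam)
    show "?ker \<subseteq> ?im"
    proof
      fix f assume "f \<in> ?ker"
      then obtain c where c: "c \<in> carrier_vec (rk (Suc (Suc n)))"
        "f = combination (rk (Suc n)) (rk (Suc (Suc n))) (b (Suc (Suc n))) c"
        using standard_basis_generates[OF sb[of n, unfolded SS_Suc]] by blast
      then have "f = \<delta> (Suc (Suc n)) c"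
        using mod_hom_eq_combination[OF hom c(1)] by (simp add: b_def)
      with c(1) show "f \<in> ?im"
        by (simp add: mod_hom.im_def[OF hom] module_vec_simps)
    qed
  qed
  have S: "S \<subseteq> carrier (free_mod p)" using assms(3,4) by (auto simp: module_vec_simps)
  have N: "submodule class_ring ?N (free_mod p)"
    by (rule LinearCombinations.module.span_is_submodule[OF module_free_mod S])
  \<comment> \<open>The end at \<open>M\<close>: the image of \<open>\<delta> 1\<close> is the span
    of \<open>S\<close>, which is the kernel of the projection.\<close>
  have "S = (\<lambda>j. \<delta> 1 (unit_vec (rk 1) j)) ` {..<rk 1}"
    using assms(3,9,14) by auto
  then have im1: "mod_hom.im (?F 1) (\<delta> 1) = mod_hom.ker (?F 0) M \<delta>0"
    using im_eq_span[OF assms(13)] ker_im_quotient(1)[OF N] assms(5,8,12) by simp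
  have im0: "mod_hom.im (?F 0) \<delta>0 = carrier M"
    using ker_im_quotient(2)[OF N] assms(5,8,12) by simp
  have hom0: "mod_hom class_ring (?F 0) M \<delta>0"
    using mod_hom_quotient[OF N] assms(5,8,12) by simp
  have exact_upto: "exact_upto n ?F \<delta> \<delta>0 M" for n
    unfolding exact_upto_def
  proof (intro conjI ballI im1 im0)
    fix k assume "k \<in> {1..n}"
    then obtain l where "k = Suc l" by (cases k) auto
    then show "mod_hom.im (?F (k + 1)) (\<delta> (k + 1)) = mod_hom.ker (?F k) (?F (k - 1)) (\<delta> k)"
      using exact[of l] by simp
  qed
  have hom': "mod_hom class_ring (?F n) (?F (n - 1)) (\<delta> n)" if "n \<ge> 1" for n
    using hom[of "n - 1"] that by simp
  have sb': "standard_basis (rk n) (ord n) (mod_hom.ker (?F n) (?F (n - 1)) (\<delta> n)) (SS n)" if "n \<ge> 1" for n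
    using sb[of "n - 1"] that by simp
  show ?thesis
    unfolding free_resolution_def
    using sb' exact_upto hom' hom0 free_module_free_mod by blast
qed

end
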